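(* Every finite simple planar graph $G$ of girth at least $5$ satisfies $\operatorname{diam}(I(G))\le 5$.
   Context: All graphs are finite, simple and undirected. The girth of a graph is the length of a shortest cycle (infinite if the graph is acyclic). An orientation of $G$ assigns a direction to each edge of $G$. Given an orientation $\vec G$ of $G$ and a set $X\subseteq V(G)$, the inversion of $X$ is the operation that reverses the orientation of every arc with both endpoints in $X$. The inversion graph $I(G)$ has as its vertices the labeled orientations of $G$, two orientations being adjacent when one is obtained from the other by a single inversion. The inversion diameter $\operatorname{diam}(I(G))$ is the diameter of $I(G)$, i.e. the largest, over all pairs of orientations of $G$, of the minimum number of inversions transforming one into the other. *)

theory Defs
  imports
    "Graph_Theory.Pair_Digraph"
    "HOL-Library.Extended_Nat"
    "HOL-Analysis.Analysis"
begin

text \<open>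
  A finite simple undirected graph is a \<^locale>\<open>pair_graph\<close>: a finite, loopless, symmetric relation,
  so that an undirected edge \<open>uv\<close> is the pair of arcs \<open>(u, v)\<close>, \<open>(v, u)\<close>.

  In a symmetric digraph the closed walk \<open>u, v, u\<close> counts as a \<^const>\<open>pre_digraph.cycle\<close>; the
  cycles of the undirected graph are those of length at least 3. The infimum of the empty set is
  infinity, so acyclic graphs have infinite girth.
\<close>

definition girth :: "'a pair_pre_digraph \<Rightarrow> enat" where
  "girth G = (INF p \<in> {p. pre_digraph.cycle (with_proj G) p \<and> length p \<ge> 3}. enat (length p))"

text \<open>
  Vertices are drawn as distinct points of the plane and edges as Jordan arcs joining their ends;
  an edge meets the drawn vertex set only in its two ends, and two different edges meet only in
  drawn vertices (hence only in common ends). The arcs \<open>(u, v)\<close> and \<open>(v, u)\<close> represent the same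
  edge and are drawn as the same curve, traversed in opposite directions.
\<close>

definition plane_drawing ::
  "'a pair_pre_digraph \<Rightarrow> ('a \<Rightarrow> complex) \<Rightarrow> ('a \<times> 'a \<Rightarrow> real \<Rightarrow> complex) \<Rightarrow> bool" where
  "plane_drawing G pos \<gamma> \<longleftrightarrow>
     inj_on pos (pverts G) \<and>
     (\<forall>(u, v) \<in> parcs G.
        Path_Connected.arc (\<gamma> (u, v)) \<and>
        pathstart (\<gamma> (u, v)) = pos u \<and> pathfinish (\<gamma> (u, v)) = pos v \<and>
        \<gamma> (v, u) = reversepath (\<gamma> (u, v)) \<and>
        path_image (\<gamma> (u, v)) \<inter> pos ` pverts G = {pos u, pos v}) \<and>
     (\<forall>e \<in> parcs G. \<forall>e' \<in> parcs G. e' \<noteq> e \<and> e' \<noteq> prod.swap e \<longrightarrow>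
        path_image (\<gamma> e) \<inter> path_image (\<gamma> e') \<subseteq> pos ` pverts G)"

definition planar :: "'a pair_pre_digraph \<Rightarrow> bool" where
  "planar G \<longleftrightarrow> (\<exists>pos \<gamma>. plane_drawing G pos \<gamma>)"

definition orientations :: "'a pair_pre_digraph \<Rightarrow> 'a rel set" where
  "orientations G = {D. D \<subseteq> parcs G \<and> (\<forall>(u, v) \<in> parcs G. (u, v) \<in> D \<longleftrightarrow> (v, u) \<notin> D)}"

definition invert :: "'a set \<Rightarrow> 'a rel \<Rightarrow> 'a rel" where
  "invert X D = (D - X \<times> X) \<union> (D \<inter> X \<times> X)\<inverse>"

text \<open>
  An inversion of a set spanning no edge changes nothing; requiring \<open>D \<noteq> D'\<close> keeps the inversion
  graph free of loops.
\<close>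

definition inversion_graph :: "'a pair_pre_digraph \<Rightarrow> 'a rel pair_pre_digraph" where
  "inversion_graph G =
     \<lparr> pverts = orientations G,
       parcs = {(D, D'). D \<in> orientations G \<and> D' \<in> orientations G \<and> D \<noteq> D' \<and>
                         (\<exists>X \<subseteq> pverts G. D' = invert X D)} \<rparr>"

definition graph_dist :: "'a pair_pre_digraph \<Rightarrow> 'a \<Rightarrow> 'a \<Rightarrow> enat" where
  "graph_dist G u v = (INF p \<in> {p. pre_digraph.awalk (with_proj G) u p v}. enat (length p))"

definition graph_diameter :: "'a pair_pre_digraph \<Rightarrow> enat" where
  "graph_diameter G = (SUP u \<in> pverts G. SUP v \<in> pverts G. graph_dist G u v)"

end

theory Submission
  imports Defs "HOL-Library.Z2"
begin

text \<open>
  Five inversions of vertex sets \<open>X\<^sub>1, \<dots>, X\<^sub>5\<close> amount to a vector \<open>x\<^sub>v \<in> F\<^sub>2\<^sup>5\<close> for each vertex, namely the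
  indicator of the sets that contain \<open>v\<close>, and they reverse the edge \<open>uv\<close> exactly when the inner
  product \<open>x\<^sub>u \<bullet> x\<^sub>v\<close> is 1. So the diameter is at most 5 as soon as every labelling of the edges by
  elements of \<open>F\<^sub>2\<close> is realised as the inner products of some vectors in \<open>F\<^sub>2\<^sup>5\<close>
  (\<open>inversion_diameter_le\<close>).

  Such vectors, all of them nonzero, exist for every triangle-free graph each of whose nonempty
  subgraphs has fewer than 5/3 times as many edges as vertices (\<open>sparse_dot_assignment\<close>). Vertices
  or edges are removed and the vectors of the smaller graph are extended; this works at a vertex of
  degree at most 1, at a vertex that has neighbours of degree 2 but not too many neighbours in all,
  and at an edge that joins two vertices of degree 3. The last case is where the labels
  have to be arbitrary: the removed edge leaves two vertices of degree 2, and labelling the two edges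
  at such a vertex by 0 and 1 forces its neighbours to get different vectors, which is precisely what
  is needed to put the edge back. A graph with none of these configurations has
  average degree at least 10/3 by discharging: a vertex of degree \<open>d\<close> starts with charge \<open>3d - 10\<close>,
  each vertex of degree 2 receives 2 from each neighbour, and each vertex of degree 3 receives 1/3
  from each neighbour (\<open>irreducible_dense\<close>).

  A planar graph of girth at least 5 has fewer than 5/3 times as many edges as vertices
  (\<open>plane_girth_5_sparse\<close>), which is the usual consequence of Euler's formula. Faces are avoided
  altogether: the inequality is shown for the part of a 2-connected drawing on and inside a cycle,
  by induction. If there is anything inside the cycle, then there is an ear through the interior, and
  the theta-curve version of the Jordan curve theorem splits the interior into the interiors of two
  cycles, for which the inequalities add up. The part on and outside the cycle becomes the part
  inside a cycle after an inversion \<open>z \<mapsto> 1 / (z - z\<^sub>0)\<close> of the plane.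
\<close>

section \<open>Linear algebra over the field with two elements\<close>

definition dot :: "'k::comm_ring_1 ^ 'n \<Rightarrow> 'k ^ 'n \<Rightarrow> 'k" where
  "dot x y = (\<Sum>i\<in>UNIV. x $ i * y $ i)"

lemma dot_commute: "dot x y = dot y x"
  by (simp add: dot_def mult.commute)

lemma dot_add_left: "dot (x + y) z = dot x z + dot y z"
  by (simp add: dot_def distrib_right sum.distrib)

lemma dot_add_right: "dot x (y + z) = dot x y + dot x z"
  by (simp add: dot_def distrib_left sum.distrib)

lemma dot_smult_left: "dot (c *s x) z = c * dot x z"
  by (simp add: dot_def sum_distrib_left mult.assoc)

lemma dot_smult_right: "dot x (c *s z) = c * dot x z"
  by (simp add: dot_def sum_distrib_left ac_simps)

lemmas dot_linear = dot_add_left dot_add_right dot_smult_left dot_smult_right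

lemma dot_axis: "dot (axis i 1) a = a $ i"
proof -
  have "dot (axis i 1) a = (\<Sum>j\<in>UNIV. if j = i then a $ j else 0)"
    unfolding dot_def by (rule sum.cong) (auto simp: axis_def)
  then show ?thesis by simp
qed

lemma UNIV_bit: "(UNIV :: bit set) = {0, 1}"
  using bit_not_zero_iff by blast

instance bit :: finite
  by standard (simp add: UNIV_bit)

lemma bit_add_self [simp]: "(b::bit) + b = 0"
  by (cases b) auto

lemma bit_add_self_left [simp]: "(b::bit) + (b + c) = c"
  by (cases b) auto

lemma bit_vec_add_self [simp]: "(x :: bit ^ 'n) + x = 0"
  unfolding vec_eq_iff vector_add_component by (simp only: bit_add_self zero_index) blast

lemma bit_vec_add_self_left [simp]: "(x :: bit ^ 'n) + (x + y) = y"
  by (simp flip: add.assoc)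

lemma bit_vec_add_eq_0_iff: "(x :: bit ^ 'n) + y = 0 \<longleftrightarrow> x = y"
  by (metis bit_vec_add_self bit_vec_add_self_left add.right_neutral)

lemma bit_sum_of_complements: "(b::bit) \<noteq> p \<Longrightarrow> c \<noteq> p \<Longrightarrow> b + (p + c) = p"
  by (cases b; cases c; cases p) auto

lemma dot_nondegenerate:
  fixes a :: "bit ^ 'n"
  assumes "a \<noteq> 0"
  obtains z where "dot z a = 1"
proof -
  obtain i where "a $ i \<noteq> 0" using assms by (auto simp: vec_eq_iff)
  then have "dot (axis i 1) a = 1" by (simp add: dot_axis)
  then show thesis by (rule that)
qed

text \<open>
  Linear independence over \<open>F\<^sub>2\<close> is spelled out by listing the span that has to be avoided; this is
  Gram-Schmidt orthogonalisation with respect to the nondegenerate form \<^const>\<open>dot\<close>, with one vector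
  eliminated here and two in the next lemma.
\<close>

lemma dual_vector_2:
  fixes a x :: "bit ^ 'n"
  assumes "a \<noteq> 0" "x \<notin> {0, a}"
  obtains z where "dot z a = 0" "dot z x = 1"
proof -
  obtain z1 where z1: "dot z1 a = 1" using dot_nondegenerate assms(1) by blast
  have "x + dot z1 x *s a \<noteq> 0"
    using assms(2) by (cases "dot z1 x") (auto simp: bit_vec_add_eq_0_iff add.assoc)
  then obtain w where w: "dot w (x + dot z1 x *s a) = 1" using dot_nondegenerate by blast
  show thesis
    by (rule that[of "w + dot w a *s z1"]) (use z1 w in \<open>auto simp: dot_linear ac_simps\<close>)
qed

lemma dual_vector_3:
  fixes a b x :: "bit ^ 'n"
  assumes "a \<noteq> 0" "b \<notin> {0, a}" "x \<notin> {0, a, b, a + b}"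
  obtains z where "dot z a = 0" "dot z b = 0" "dot z x = 1"
proof -
  obtain z1 where z1: "dot z1 b = 0" "dot z1 a = 1"
    using dual_vector_2[of b a] assms by auto
  obtain z2 where z2: "dot z2 a = 0" "dot z2 b = 1"
    using dual_vector_2[of a b] assms by auto
  define x' where "x' = x + dot z1 x *s a + dot z2 x *s b"
  have "x' \<noteq> 0"
    using assms(3) unfolding x'_def
    by (cases "dot z1 x"; cases "dot z2 x") (auto simp: bit_vec_add_eq_0_iff add.assoc)
  then obtain w where w: "dot w x' = 1" using dot_nondegenerate by blast
  show thesis
    by (rule that[of "w + dot w a *s z1 + dot w b *s z2"])
      (use z1 z2 w in \<open>auto simp: x'_def dot_linear ac_simps\<close>)
qed

lemma dot_system_1:
  fixes a :: "bit ^ 'n"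
  assumes "a \<noteq> 0"
  obtains y where "dot y a = p"
proof -
  obtain z where "dot z a = 1" using dot_nondegenerate[OF assms] .
  then show thesis by (intro that[of "p *s z"]) (simp add: dot_linear)
qed

lemma dot_system_2:
  fixes a b :: "bit ^ 'n"
  assumes "a \<noteq> 0" "b \<notin> {0, a}"
  obtains y where "dot y a = p" "dot y b = q"
proof -
  obtain y0 where y0: "dot y0 a = p" using dot_system_1 assms(1) .
  obtain z where "dot z a = 0" "dot z b = 1" using dual_vector_2 assms .
  then show thesis using y0
    by (intro that[of "y0 + (q + dot y0 b) *s z"]) (auto simp: dot_linear ac_simps)
qed

lemma dot_system_3:
  fixes a b c :: "bit ^ 'n"
  assumes "a \<noteq> 0" "b \<notin> {0, a}" "c \<notin> {0, a, b, a + b}"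
  obtains y where "dot y a = p" "dot y b = q" "dot y c = r"
proof -
  obtain y0 where y0: "dot y0 a = p" "dot y0 b = q" using dot_system_2 assms(1,2) .
  obtain z where "dot z a = 0" "dot z b = 0" "dot z c = 1" using dual_vector_3 assms .
  then show thesis using y0
    by (intro that[of "y0 + (r + dot y0 c) *s z"]) (auto simp: dot_linear ac_simps)
qed

lemma card_bit_vec: "card (UNIV :: (bit ^ 'n) set) = 2 ^ CARD('n)"
proof -
  have "CARD(bit) = 2" by (simp add: UNIV_bit)
  then show ?thesis by (simp only: CARD_vec)
qed

definition dot_solutions :: "'a set \<Rightarrow> ('a \<Rightarrow> bit ^ 'n) \<Rightarrow> ('a \<Rightarrow> bit) \<Rightarrow> (bit ^ 'n) set" where
  "dot_solutions N X p = {y. \<forall>w\<in>N. dot y (X w) = p w}"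

text \<open>
  Each equation cuts the affine solution space to itself, to nothing, or to half of it: if \<open>x\<^sub>0\<close>
  satisfies the new equation and \<open>x\<^sub>1\<close> violates it, translation by \<open>x\<^sub>0 + x\<^sub>1\<close> maps the solutions
  that violate it injectively to those that satisfy it.
\<close>

lemma card_dot_solutions:
  fixes X :: "'a \<Rightarrow> bit ^ 'n"
  assumes "finite N" "dot_solutions N X p \<noteq> {}"
  shows "2 ^ CARD('n) \<le> card (dot_solutions N X p) * 2 ^ card N"
  using assms
proof (induction N rule: finite_induct)
  case empty
  then show ?case by (simp add: dot_solutions_def card_bit_vec del: CARD_vec)
next
  case (insert w N)
  let ?S = "dot_solutions N X p" and ?T = "dot_solutions (insert w N) X p"
  obtain x0 where x0: "x0 \<in> ?T" using insert.prems by auto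
  have IH: "2 ^ CARD('n) \<le> card ?S * 2 ^ card N"
    using insert.IH x0 by (auto simp: dot_solutions_def)
  have "card (?S - ?T) \<le> card ?T"
  proof (cases "?S - ?T = {}")
    case False
    then obtain x1 where x1: "x1 \<in> ?S - ?T" by blast
    have "(\<lambda>z. z + (x0 + x1)) ` (?S - ?T) \<subseteq> ?T"
    proof clarsimp
      fix z assume z: "z \<in> ?S" "z \<notin> ?T"
      have "dot (z + (x0 + x1)) (X v) = p v" if "v \<in> N" for v
        using z(1) x0 x1 that by (simp add: dot_solutions_def dot_linear)
      moreover have "dot z (X w) \<noteq> p w" "dot x1 (X w) \<noteq> p w" "dot x0 (X w) = p w"
        using z x0 x1 unfolding dot_solutions_def by blast+
      then have "dot (z + (x0 + x1)) (X w) = p w"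
        unfolding dot_add_left by (metis bit_sum_of_complements)
      ultimately show "z + (x0 + x1) \<in> ?T" by (auto simp: dot_solutions_def)
    qed
    moreover have "inj_on (\<lambda>z. z + (x0 + x1)) (?S - ?T)" by (rule inj_onI) simp
    ultimately show ?thesis by (meson card_inj_on_le finite)
  next
    case True
    then show ?thesis by (simp only: card.empty le0)
  qed
  moreover have "card ?S = card ?T + card (?S - ?T)"
    by (subst card_Un_disjoint[symmetric]) (auto simp: dot_solutions_def intro: arg_cong[where f = card])
  ultimately have "card ?S \<le> 2 * card ?T" by simp
  then have "card ?S * 2 ^ card N \<le> 2 * card ?T * 2 ^ card N" by (rule mult_right_mono) simp
  also have "\<dots> = card ?T * 2 ^ card (insert w N)" using insert.hyps by simp
  finally show ?case using IH by (rule order_trans[rotated])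
qed

lemma nonzero_dot_solution:
  fixes X :: "'a \<Rightarrow> bit ^ 'n"
  assumes "finite N" "dot_solutions N X p \<noteq> {}" "card N < CARD('n)"
  obtains y where "y \<in> dot_solutions N X p" "y \<noteq> 0"
proof -
  have "\<not> dot_solutions N X p \<subseteq> {0}"
  proof
    assume "dot_solutions N X p \<subseteq> {0}"
    then have "card (dot_solutions N X p) \<le> 1" using card_mono[of "{0}" "dot_solutions N X p"] by simp
    then have "card (dot_solutions N X p) * 2 ^ card N \<le> 2 ^ card N" by simp
    also have "\<dots> < 2 ^ CARD('n)" using assms(3) by simp
    finally show False using card_dot_solutions[OF assms(1,2)] by simp
  qed
  then show thesis using that by blast
qed

text \<open>
  This puts back an edge between two vertices of degree 3. The vector \<open>x\<close> has \<open>2\<^sup>3\<close> candidates,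
  at most four of which lie in the span of \<open>c\<close> and \<open>d\<close>; for any other candidate the three
  conditions on \<open>y\<close> are independent. Dimension 5 is used here: with \<open>2\<^sup>2\<close> candidates for \<open>x\<close> the
  count would fail.
\<close>

lemma dot_system_coupled:
  fixes a b c d :: "bit ^ 5"
  assumes "a \<noteq> 0" "b \<noteq> 0" "a \<noteq> b" "c \<noteq> 0" "d \<noteq> 0" "c \<noteq> d"
  obtains x y where "x \<noteq> 0" "y \<noteq> 0" "dot x a = p" "dot x b = q" "dot y c = r" "dot y d = s"
    "dot x y = t"
proof -
  let ?A = "dot_solutions {a, b} id (\<lambda>w. if w = a then p else q)"
  have "?A \<noteq> {}"
    using dot_system_2[of a b p q] assms by (auto simp: dot_solutions_def)
  from card_dot_solutions[OF _ this] have "8 \<le> card ?A" using assms by simp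
  moreover have "card {0, c, d, c + d} \<le> 4" by (simp add: card_insert_if)
  ultimately have "\<not> ?A \<subseteq> {0, c, d, c + d}" using card_mono[of "{0, c, d, c + d}" ?A] by fastforce
  then obtain x where x: "x \<in> ?A" "x \<notin> {0, c, d, c + d}" by blast
  let ?p = "\<lambda>w. if w = c then r else if w = d then s else t"
  let ?B = "dot_solutions {c, d, x} id ?p"
  obtain y0 where "dot y0 c = r" "dot y0 d = s" "dot y0 x = t"
    using dot_system_3[of c d x r s t] assms x by auto
  then have "y0 \<in> ?B" using assms x by (auto simp: dot_solutions_def)
  moreover have "card {c, d, x} \<le> 3" by (simp add: card_insert_if)
  then have "card {c, d, x} < CARD(5)" by simp
  ultimately obtain y where "y \<in> ?B" "y \<noteq> 0"
    using nonzero_dot_solution[of "{c, d, x}" id ?p] by auto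
  then show thesis using x assms
    by (intro that[of x y]) (auto simp: dot_solutions_def dot_commute[of x y])
qed

section \<open>Labelled graphs and inner products\<close>

locale fin_sgraph =
  fixes V :: "'a set" and A :: "'a rel"
  assumes finite_verts: "finite V"
    and arcs_subset: "A \<subseteq> V \<times> V"
    and sym_arcs: "sym A"
    and irrefl_arcs: "irrefl A"
begin

lemma finite_arcs: "finite A"
  using finite_verts arcs_subset by (meson finite_SigmaI finite_subset)

lemma arcD: "(u, v) \<in> A \<Longrightarrow> u \<in> V \<and> v \<in> V \<and> u \<noteq> v \<and> (v, u) \<in> A"
  using arcs_subset sym_arcs irrefl_arcs by (auto simp: irrefl_def dest: symD)

lemma finite_neighbours [simp]: "finite (A `` X)"
  using finite_arcs by (simp add: finite_Image)

lemma neighbour_commute: "u \<in> A `` {v} \<longleftrightarrow> v \<in> A `` {u}"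
  using arcD by blast

lemma subgraph:
  assumes "W \<subseteq> V" "B \<subseteq> A" "B \<subseteq> W \<times> W" "sym B"
  shows "fin_sgraph W B"
  using assms finite_verts irrefl_arcs
  by unfold_locales (auto simp: irrefl_def intro: finite_subset)

lemma sum_degree: "(\<Sum>v\<in>V. card (A `` {v})) = card A"
proof -
  have "card A = card (Sigma V (\<lambda>v. A `` {v}))"
    using arcs_subset by (intro arg_cong[where f = card]) auto
  also have "\<dots> = (\<Sum>v\<in>V. card (A `` {v}))" using finite_verts by simp
  finally show ?thesis by simp
qed

text \<open>
  Double counting for the discharging argument: what the vertices of \<open>T\<close> receive is what their
  neighbours send.
\<close>

lemma sum_card_neighbours_in:
  assumes "T \<subseteq> V"
  shows "(\<Sum>v\<in>V. card (A `` {v} \<inter> T)) = (\<Sum>t\<in>T. card (A `` {t}))"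
proof -
  have fin: "finite T" using assms finite_verts finite_subset by blast
  have "(\<Sum>v\<in>V. card (A `` {v} \<inter> T)) = card (Sigma V (\<lambda>v. A `` {v} \<inter> T))"
    using finite_verts by simp
  also have "\<dots> = card (Sigma T (\<lambda>t. A `` {t}))"
  proof (rule bij_betw_same_card)
    show "bij_betw prod.swap (Sigma V (\<lambda>v. A `` {v} \<inter> T)) (Sigma T (\<lambda>t. A `` {t}))"
      using assms arcD by (intro bij_betwI[where g = prod.swap]) auto
  qed
  also have "\<dots> = (\<Sum>t\<in>T. card (A `` {t}))" using fin by simp
  finally show ?thesis .
qed

lemma neighbours_2E:
  assumes "card (A `` {t}) = 2" "u \<in> A `` {t}"
  obtains w where "A `` {t} = {u, w}" "w \<noteq> u"
proof -
  have "card (A `` {t} - {u}) = 1" using assms by simp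
  then obtain w where "A `` {t} - {u} = {w}" by (auto simp: card_1_singleton_iff)
  then show thesis using assms(2) by (intro that[of w]) auto
qed

lemma neighbours_3E:
  assumes "card (A `` {t}) = 3" "u \<in> A `` {t}"
  obtains a b where "A `` {t} = {u, a, b}" "a \<noteq> u" "b \<noteq> u" "a \<noteq> b"
proof -
  have "card (A `` {t} - {u}) = 2" using assms by simp
  then obtain a b where "A `` {t} - {u} = {a, b}" "a \<noteq> b" by (auto simp: card_2_iff)
  then show thesis using assms(2) by (intro that[of a b]) auto
qed

end

text \<open>
  The vectors are required to be nonzero so that an assignment extends to a new vertex of degree 1,
  and so that two different ones are linearly independent.
\<close>

definition dot_assignment :: "'a rel \<Rightarrow> 'a set \<Rightarrow> ('a \<Rightarrow> 'a \<Rightarrow> bit) \<Rightarrow> ('a \<Rightarrow> bit ^ 'n) \<Rightarrow> bool" where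
  "dot_assignment A W p X \<longleftrightarrow>
     (\<forall>v\<in>W. X v \<noteq> 0) \<and> (\<forall>u\<in>W. \<forall>v\<in>W. (u, v) \<in> A \<longrightarrow> dot (X u) (X v) = p u v)"

lemma dot_assignmentI:
  assumes "\<And>v. v \<in> W \<Longrightarrow> X v \<noteq> 0"
    and "\<And>u v. u \<in> W \<Longrightarrow> v \<in> W \<Longrightarrow> (u, v) \<in> A \<Longrightarrow> dot (X u) (X v) = p u v"
  shows "dot_assignment A W p X"
  using assms unfolding dot_assignment_def by blast

lemma dot_assignmentD:
  assumes "dot_assignment A W p X"
  shows "v \<in> W \<Longrightarrow> X v \<noteq> 0"
    and "u \<in> W \<Longrightarrow> v \<in> W \<Longrightarrow> (u, v) \<in> A \<Longrightarrow> dot (X u) (X v) = p u v"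
  using assms unfolding dot_assignment_def by blast+

context fin_sgraph
begin

text \<open>
  Pairwise non-adjacent new vertices can be given their vectors independently of each other.
\<close>

lemma dot_assignment_extend:
  fixes X :: "'a \<Rightarrow> bit ^ 'n"
  assumes X: "dot_assignment A W p X"
    and p: "\<And>u v. p u v = p v u"
    and T: "T \<inter> W = {}" "A \<inter> T \<times> T = {}"
    and ext: "\<And>t. t \<in> T \<Longrightarrow> \<exists>y. y \<noteq> 0 \<and> y \<in> dot_solutions (A `` {t} \<inter> W) X (p t)"
  shows "\<exists>X' :: 'a \<Rightarrow> bit ^ 'n. dot_assignment A (W \<union> T) p X'"
proof -
  obtain Y where Y: "\<And>t. t \<in> T \<Longrightarrow> Y t \<noteq> 0 \<and> Y t \<in> dot_solutions (A `` {t} \<inter> W) X (p t)"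
    using ext by metis
  define X' where "X' v = (if v \<in> T then Y v else X v)" for v
  have XW: "X' v = X v" if "v \<in> W" for v using that T by (auto simp: X'_def)
  have TW: "dot (X' t) (X' w) = p t w" if "t \<in> T" "w \<in> W" "(t, w) \<in> A" for t w
    using Y[of t] that T by (auto simp: X'_def dot_solutions_def)
  have "dot (X' u) (X' v) = p u v" if uv: "u \<in> W \<union> T" "v \<in> W \<union> T" "(u, v) \<in> A" for u v
  proof (cases "u \<in> T")
    case True
    then show ?thesis using TW uv T by blast
  next
    case False
    show ?thesis
    proof (cases "v \<in> T")
      case True
      then have "dot (X' v) (X' u) = p v u" using TW uv False arcD by blast
      then show ?thesis using p dot_commute by metis
    next
      case False
      then show ?thesis using \<open>u \<notin> T\<close> uv X XW by (auto simp: dot_assignment_def)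
    qed
  qed
  moreover have "X' v \<noteq> 0" if "v \<in> W \<union> T" for v
    using that X Y by (auto simp: X'_def dot_assignment_def)
  ultimately have "dot_assignment A (W \<union> T) p X'" unfolding dot_assignment_def by blast
  then show ?thesis by blast
qed

lemma reduce_degree_le_1:
  fixes X :: "'a \<Rightarrow> bit ^ 5"
  assumes X: "dot_assignment A (V - {v}) p X"
    and p: "\<And>u v. p u v = p v u"
    and v: "v \<in> V" "card (A `` {v}) \<le> 1"
  shows "\<exists>X' :: 'a \<Rightarrow> bit ^ 5. dot_assignment A V p X'"
proof -
  have N: "A `` {v} \<inter> (V - {v}) = A `` {v}" using arcD by auto
  have "dot_solutions (A `` {v}) X (p v) \<noteq> {}"
  proof (cases "A `` {v} = {}")
    case False
    then have "card (A `` {v}) = 1" using v(2) by (simp add: le_Suc_eq)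
    then obtain w where w: "A `` {v} = {w}" by (auto simp: card_1_singleton_iff)
    then have "w \<in> V - {v}" using N by blast
    then have "X w \<noteq> 0" using X by (auto simp: dot_assignment_def)
    then obtain y where "dot y (X w) = p v w" using dot_system_1[of "X w"] by blast
    then show ?thesis using w by (auto simp: dot_solutions_def)
  qed (auto simp: dot_solutions_def)
  from nonzero_dot_solution[OF _ this] v
  obtain y where "y \<in> dot_solutions (A `` {v}) X (p v)" "y \<noteq> 0" by auto
  moreover have "A \<inter> {v} \<times> {v} = {}" using arcD by blast
  ultimately have "\<exists>X' :: 'a \<Rightarrow> bit ^ 5. dot_assignment A (V - {v} \<union> {v}) p X'"
    using N by (intro dot_assignment_extend[OF X p]) auto
  moreover have "V - {v} \<union> {v} = V" using v(1) by blast
  ultimately show ?thesis by simp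
qed

text \<open>
  A neighbour of degree 2 can be put back as soon as its two neighbours carry different vectors. So
  with all neighbours of degree 2 removed, the vector of \<open>u\<close> is chosen again: it ranges over at least
  \<open>2\<^sup>5\<^sup>-\<^sup>m\<close> vectors, where \<open>m\<close> is the number of the other neighbours, and it has to avoid 0 and the
  vector of the second neighbour of each vertex in \<open>K\<close>. Triangle-freeness ensures that these second
  neighbours are not removed themselves.
\<close>

lemma reduce_degree_2_neighbours:
  fixes X :: "'a \<Rightarrow> bit ^ 5" and u :: 'a
  defines "K \<equiv> {t \<in> A `` {u}. card (A `` {t}) = 2}"
  assumes X: "dot_assignment A (V - K) p X"
    and p: "\<And>u v. p u v = p v u"
    and triangle_free: "\<And>a b c. (a, b) \<in> A \<Longrightarrow> (b, c) \<in> A \<Longrightarrow> (c, a) \<notin> A"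
    and u: "u \<in> V"
    and few: "2 ^ card (A `` {u} - K) * (card K + 1) < (32 :: nat)"
  shows "\<exists>X' :: 'a \<Rightarrow> bit ^ 5. dot_assignment A V p X'"
proof -
  let ?S = "dot_solutions (A `` {u} - K) X (p u)"
  have finK: "finite K"
    unfolding K_def by (rule finite_subset[OF _ finite_neighbours[of "{u}"]]) auto
  have uK: "u \<notin> K" using arcD by (auto simp: K_def)
  have KV: "K \<subseteq> V" using arcD by (auto simp: K_def)
  have "\<exists>w. A `` {t} = {u, w} \<and> w \<noteq> u" if "t \<in> K" for t
    using that neighbours_2E[of t u] neighbour_commute by (auto simp: K_def) metis
  then obtain other where other: "\<And>t. t \<in> K \<Longrightarrow> A `` {t} = {u, other t} \<and> other t \<noteq> u"
    by metis
  have indep: "A \<inter> K \<times> K = {}"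
  proof -
    have False if "s \<in> K" "t \<in> K" "(s, t) \<in> A" for s t
    proof -
      have "(u, s) \<in> A" "(t, u) \<in> A" using that arcD by (auto simp: K_def)
      then show False using triangle_free that(3) by blast
    qed
    then show ?thesis by blast
  qed
  have other_VK: "other t \<in> V - K" if "t \<in> K" for t
  proof -
    have "(t, other t) \<in> A" using other[OF that] by blast
    then show ?thesis using indep that arcD by blast
  qed
  have "dot (X u) (X w) = p u w" if "w \<in> A `` {u} - K" for w
    using dot_assignmentD(2)[OF X] u uK arcD that by blast
  then have "X u \<in> ?S" by (simp add: dot_solutions_def)
  then have "?S \<noteq> {}" by blast
  from card_dot_solutions[OF _ this]
  have "32 \<le> card ?S * 2 ^ card (A `` {u} - K)" by simp
  then have "card K + 1 < card ?S"
  proof (rule contrapos_pp)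
    assume "\<not> card K + 1 < card ?S"
    then have "card ?S * 2 ^ card (A `` {u} - K) \<le> (card K + 1) * 2 ^ card (A `` {u} - K)"
      by (intro mult_right_mono) auto
    then show "\<not> 32 \<le> card ?S * 2 ^ card (A `` {u} - K)"
      using few by (simp add: mult.commute)
  qed
  moreover have "card (insert 0 ((X \<circ> other) ` K)) \<le> card K + 1"
    using finK card_image_le[OF finK, of "X \<circ> other"] by (simp add: card_insert_if)
  ultimately have "\<not> ?S \<subseteq> insert 0 ((X \<circ> other) ` K)"
    using finK card_mono[of "insert 0 ((X \<circ> other) ` K)" ?S] by force
  then obtain y where y: "y \<in> ?S" "y \<noteq> 0" "\<And>t. t \<in> K \<Longrightarrow> y \<noteq> X (other t)" by auto
  obtain X1 where X1: "dot_assignment A ((V - K - {u}) \<union> {u}) p X1"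
      and X1_old: "\<And>v. v \<in> V - K - {u} \<Longrightarrow> X1 v = X v" and X1u: "X1 u = y"
  proof -
    define X1 where "X1 = X(u := y)"
    have "dot y (X w) = p u w" if "w \<in> V - K - {u}" "(u, w) \<in> A" for w
      using y(1) that by (auto simp: dot_solutions_def)
    moreover from this have "dot (X w) y = p w u" if "w \<in> V - K - {u}" "(w, u) \<in> A" for w
      using that arcD p dot_commute by metis
    moreover have "dot (X v) (X w) = p v w"
      if "v \<in> V - K - {u}" "w \<in> V - K - {u}" "(v, w) \<in> A" for v w
      using dot_assignmentD(2)[OF X] that by blast
    ultimately have "dot_assignment A ((V - K - {u}) \<union> {u}) p X1"
      using y(2) dot_assignmentD(1)[OF X] irrefl_arcs
      by (intro dot_assignmentI) (auto simp: X1_def irrefl_def split: if_splits)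
    then show thesis by (rule that[of X1]) (auto simp: X1_def)
  qed
  have W: "(V - K - {u}) \<union> {u} = V - K" using u uK by blast
  have "\<exists>y. y \<noteq> 0 \<and> y \<in> dot_solutions (A `` {t} \<inter> (V - K)) X1 (p t)" if t: "t \<in> K" for t
  proof -
    have N: "A `` {t} \<inter> (V - K) = {u, other t}" using other[OF t] other_VK[OF t] u uK by blast
    have "X1 u \<noteq> 0" "X1 (other t) \<noteq> 0"
      using dot_assignmentD(1)[OF X1] other_VK[OF t] by auto
    moreover have "X1 u \<noteq> X1 (other t)"
      using other[OF t] other_VK[OF t] X1_old[of "other t"] X1u y(3)[OF t] by auto
    ultimately
    obtain z where "dot z (X1 u) = p t u" "dot z (X1 (other t)) = p t (other t)"
      using dot_system_2[of "X1 u" "X1 (other t)"] by auto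
    then have "dot_solutions {u, other t} X1 (p t) \<noteq> {}" by (auto simp: dot_solutions_def)
    moreover have "card {u, other t} < CARD(5)" by (simp add: card_insert_if)
    ultimately obtain y where "y \<in> dot_solutions {u, other t} X1 (p t)" "y \<noteq> 0"
      using nonzero_dot_solution[of "{u, other t}" X1 "p t"] by blast
    then show ?thesis unfolding N by blast
  qed
  then have "\<exists>X' :: 'a \<Rightarrow> bit ^ 5. dot_assignment A ((V - K) \<union> K) p X'"
    using dot_assignment_extend[OF X1[unfolded W] p Diff_disjoint indep] by blast
  moreover have "(V - K) \<union> K = V" using KV by blast
  ultimately show ?thesis by simp
qed

text \<open>
  Deleting the edge \<open>uv\<close> leaves \<open>v\<close> with neighbours \<open>a, b\<close> and \<open>u\<close> with neighbours \<open>c, d\<close>. The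
  vectors found for \<open>u\<close> and \<open>v\<close> in the smaller graph are thrown away; these vertices serve only to
  force \<open>a, b\<close> and \<open>c, d\<close> to carry different vectors, by means of the labels 0 and 1.
\<close>

lemma reduce_adjacent_degree_3:
  assumes uv: "(u, v) \<in> A" "card (A `` {u}) = 3" "card (A `` {v}) = 3"
    and p: "\<And>u v. p u v = p v u"
    and IH: "\<And>q. (\<And>u v. q u v = q v u) \<Longrightarrow>
      \<exists>X :: 'a \<Rightarrow> bit ^ 5. dot_assignment (A - {(u, v), (v, u)}) V q X"
  shows "\<exists>X :: 'a \<Rightarrow> bit ^ 5. dot_assignment A V p X"
proof -
  have uvV: "u \<in> V" "v \<in> V" "u \<noteq> v" "(v, u) \<in> A" using arcD uv by auto
  obtain a b where ab: "A `` {v} = {u, a, b}" "a \<noteq> u" "b \<noteq> u" "a \<noteq> b"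
    using neighbours_3E[of v u] uv uvV by blast
  obtain c d where cd: "A `` {u} = {v, c, d}" "c \<noteq> v" "d \<noteq> v" "c \<noteq> d"
    using neighbours_3E[of u v] uv uvV by blast
  have arcs: "(v, a) \<in> A" "(v, b) \<in> A" "(u, c) \<in> A" "(u, d) \<in> A" using ab cd by blast+
  then have abcd: "a \<in> V" "b \<in> V" "c \<in> V" "d \<in> V" "a \<noteq> v" "b \<noteq> v" "c \<noteq> u" "d \<noteq> u"
    using arcD by blast+
  \<comment> \<open>the labels 0 and 1 on the remaining edges at \<open>v\<close> and at \<open>u\<close>, the given labels elsewhere\<close>
  define q where "q x y = (if {x, y} \<in> {{v, b}, {u, d}} then 1
    else if {x, y} \<in> {{v, a}, {u, c}} then 0 else p x y)" for x y
  have "q x y = q y x" for x y using p by (simp add: q_def insert_commute)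
  from IH[of q, OF this]
  obtain X :: "'a \<Rightarrow> bit ^ 5" where X: "dot_assignment (A - {(u, v), (v, u)}) V q X" by blast
  have nz: "X w \<noteq> 0" if "w \<in> V" for w using X that by (auto simp: dot_assignment_def)
  have Xq: "dot (X x) (X y) = q x y" if "(x, y) \<in> A" "(x, y) \<noteq> (u, v)" "(x, y) \<noteq> (v, u)" for x y
    using X that arcD[OF that(1)] by (auto simp: dot_assignment_def)
  have "dot (X v) (X a) = 0" "dot (X v) (X b) = 1" "dot (X u) (X c) = 0" "dot (X u) (X d) = 1"
    using Xq[of v a] Xq[of v b] Xq[of u c] Xq[of u d] arcs ab cd abcd uvV
    by (auto simp: q_def doubleton_eq_iff)
  then have "X a \<noteq> X b" "X c \<noteq> X d" by auto
  then obtain x y where xy: "x \<noteq> 0" "y \<noteq> 0" "dot x (X a) = p v a" "dot x (X b) = p v b"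
      "dot y (X c) = p u c" "dot y (X d) = p u d" "dot x y = p v u"
    using dot_system_coupled[of "X a" "X b" "X c" "X d"] nz abcd by metis
  define X' where "X' = X(v := x, u := y)"
  have v_arcs: "dot (X' v) (X' w) = p v w" if "(v, w) \<in> A" for w
  proof -
    have "w \<in> {u, a, b}" using that ab(1) by blast
    then show ?thesis using xy ab abcd uvV by (auto simp: X'_def)
  qed
  have u_arcs: "dot (X' u) (X' w) = p u w" if "(u, w) \<in> A" for w
  proof -
    have "w \<in> {v, c, d}" using that cd(1) by blast
    then show ?thesis using xy cd abcd uvV p[of u v] by (auto simp: X'_def dot_commute[of y x])
  qed
  have "dot (X' s) (X' t) = p s t" if st: "(s, t) \<in> A" for s t
  proof -
    consider "s = v" | "s = u" | "t = v" | "t = u" | "s \<notin> {u, v}" "t \<notin> {u, v}" by blast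
    then show ?thesis
    proof cases
      case 5
      then have "q s t = p s t" by (auto simp: q_def doubleton_eq_iff)
      then show ?thesis using Xq[OF st] 5 by (auto simp: X'_def)
    qed (use st v_arcs u_arcs arcD p dot_commute in metis)+
  qed
  moreover have "X' w \<noteq> 0" if "w \<in> V" for w using nz[OF that] xy by (auto simp: X'_def)
  ultimately show ?thesis by (auto simp: dot_assignment_def)
qed

text \<open>
  Discharging, with all charges multiplied by 3: a vertex of degree \<open>d\<close> has charge \<open>9d - 30\<close>, sends
  6 to each neighbour of degree 2 and 1 to each neighbour of degree 3. In terms of
  the number \<open>k\<close> of neighbours of degree 2 and the number \<open>m\<close> of the others, a vertex of degree at
  least 4 keeps at least \<open>8m + 3k - 30\<close>, and the assumption on \<open>k\<close> makes this nonnegative. Vertices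
  of degree 2 and 3 start with -12 and -3 and receive exactly that amount, because the hypotheses
  imply that two vertices of degree 2 or 3 are never adjacent.
\<close>

lemma irreducible_dense:
  defines "T2 \<equiv> {v \<in> V. card (A `` {v}) = 2}" and "T3 \<equiv> {v \<in> V. card (A `` {v}) = 3}"
  assumes deg: "\<And>v. v \<in> V \<Longrightarrow> 2 \<le> card (A `` {v})"
    and many2: "\<And>v. v \<in> V \<Longrightarrow> A `` {v} \<inter> T2 \<noteq> {} \<Longrightarrow>
      32 \<le> 2 ^ card (A `` {v} - T2) * (card (A `` {v} \<inter> T2) + 1)"
    and indep3: "A \<inter> T3 \<times> T3 = {}"
  shows "10 * card V \<le> 3 * card A"
proof -
  have fin: "finite T2" "finite T3" using finite_verts by (auto simp: T2_def T3_def)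
  have sub: "T2 \<subseteq> V" "T3 \<subseteq> V" by (auto simp: T2_def T3_def)
  have split: "card (A `` {v}) = card (A `` {v} - T2) + card (A `` {v} \<inter> T2)" for v
    by (subst card_Un_disjoint[symmetric]) (auto intro: arg_cong[where f = card])
  \<comment> \<open>a vertex of degree 3 with a neighbour of degree 2 violates the assumption on such neighbours\<close>
  have T2_T3: "A \<inter> T2 \<times> T3 = {}"
  proof -
    have False if "(u, v) \<in> A" "u \<in> T2" "v \<in> T3" for u v
    proof -
      define k where "k = card (A `` {v} \<inter> T2)"
      define m where "m = card (A `` {v} - T2)"
      have "u \<in> A `` {v} \<inter> T2" using that arcD by blast
      then have "k \<noteq> 0" "32 \<le> 2 ^ m * (k + 1)"
        using many2[of v] that(3) by (auto simp: k_def m_def T3_def card_eq_0_iff)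
      moreover have "m + k = 3" using split[of v] that(3) by (simp add: k_def m_def T3_def)
      then have "m = 0 \<and> k = 3 \<or> m = 1 \<and> k = 2 \<or> m = 2 \<and> k = 1 \<or> k = 0" by arith
      ultimately show False by auto
    qed
    then show ?thesis by blast
  qed
  have "30 + 6 * card (A `` {v} \<inter> T2) + card (A `` {v} \<inter> T3)
      \<le> 9 * card (A `` {v}) + (if v \<in> T2 then 12 else 0) + (if v \<in> T3 then 3 else 0)"
    if v: "v \<in> V" for v
  proof -
    define k where "k = card (A `` {v} \<inter> T2)"
    define m where "m = card (A `` {v} - T2)"
    have d: "card (A `` {v}) = m + k" using split by (simp add: m_def k_def)
    have t: "card (A `` {v} \<inter> T3) \<le> m"
      unfolding m_def by (intro card_mono) (auto simp: T2_def T3_def)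
    have t0: "card (A `` {v} \<inter> T3) = 0" if "v \<in> T2 \<or> v \<in> T3"
    proof -
      have "A `` {v} \<inter> T3 = {}" using indep3 T2_T3 that by blast
      then show ?thesis by simp
    qed
    have k: "k = 0 \<or> 32 \<le> 2 ^ m * (k + 1)"
      using many2[OF v] by (auto simp: m_def k_def)
    have d2: "2 \<le> m + k" using deg[OF v] d by simp
    have T2_iff: "v \<in> T2 \<longleftrightarrow> m + k = 2" and T3_iff: "v \<in> T3 \<longleftrightarrow> m + k = 3"
      using v d by (auto simp: T2_def T3_def)
    consider "m = 0" | "m = 1" | "m = 2" | "m = 3" | "m = 4" | "m \<ge> 5" by linarith
    then show ?thesis
      unfolding d k_def[symmetric] T2_iff T3_iff using k t t0[unfolded T2_iff T3_iff] d2
      by cases auto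
  qed
  then have "(\<Sum>v\<in>V. 30 + 6 * card (A `` {v} \<inter> T2) + card (A `` {v} \<inter> T3))
      \<le> (\<Sum>v\<in>V. 9 * card (A `` {v}) + (if v \<in> T2 then 12 else 0) + (if v \<in> T3 then 3 else 0))"
    by (rule sum_mono)
  moreover have "(\<Sum>v\<in>V. card (A `` {v} \<inter> T2)) = 2 * card T2"
    using sum_card_neighbours_in[OF sub(1)] by (simp add: T2_def)
  moreover have "(\<Sum>v\<in>V. card (A `` {v} \<inter> T3)) = 3 * card T3"
    using sum_card_neighbours_in[OF sub(2)] by (simp add: T3_def)
  moreover have "(\<Sum>v\<in>V. if v \<in> T2 then 12 else 0 :: nat) = 12 * card T2"
    "(\<Sum>v\<in>V. if v \<in> T3 then 3 else 0 :: nat) = 3 * card T3"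
    using finite_verts sub by (simp_all add: sum.If_cases Int_absorb1)
  ultimately show ?thesis
    using sum_degree by (simp add: sum.distrib sum_distrib_left[symmetric])
qed

end

text \<open>
  In a minimal counterexample none of the three reductions applies, so it is too dense. Since the
  reduction at two vertices of degree 3 changes the labels, the induction is over all labellings.
\<close>

lemma sparse_dot_assignment:
  assumes "fin_sgraph V A"
    and "\<And>a b c. (a, b) \<in> A \<Longrightarrow> (b, c) \<in> A \<Longrightarrow> (c, a) \<notin> A"
    and "\<And>W B. W \<subseteq> V \<Longrightarrow> W \<noteq> {} \<Longrightarrow> B \<subseteq> A \<Longrightarrow> B \<subseteq> W \<times> W \<Longrightarrow> sym B \<Longrightarrow> 3 * card B < 10 * card W"
    and "\<And>u v. p u v = p v u"
  shows "\<exists>X :: 'a \<Rightarrow> bit ^ 5. dot_assignment A V p X"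
  using assms
proof (induction "card V + card A" arbitrary: V A p rule: less_induct)
  case less
  interpret fin_sgraph V A by (rule less.prems)
  note tri = less.prems(2) and sparse = less.prems(3) and p = less.prems(4)
  have smaller: "\<exists>X :: 'a \<Rightarrow> bit ^ 5. dot_assignment B W q X"
    if WB: "W \<subseteq> V" "B \<subseteq> A" "B \<subseteq> W \<times> W" "sym B" "W \<subset> V \<or> B \<subset> A" and q: "\<And>u v. q u v = q v u"
    for W B q
  proof (rule less.hyps)
    have "card W \<le> card V" "card B \<le> card A"
      using WB finite_verts finite_arcs by (auto intro: card_mono)
    moreover have "card W < card V \<or> card B < card A"
      using WB(5) finite_verts finite_arcs by (auto intro: psubset_card_mono)
    ultimately show "card W + card B < card V + card A" by linarith
    show "fin_sgraph W B" using WB subgraph by blast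
    show "(c, a) \<notin> B" if "(a, b) \<in> B" "(b, c) \<in> B" for a b c
      using tri[of a b c] that WB(2) by blast
    show "3 * card B' < 10 * card W'"
      if "W' \<subseteq> W" "W' \<noteq> {}" "B' \<subseteq> B" "B' \<subseteq> W' \<times> W'" "sym B'" for W' B'
      by (rule sparse[OF subset_trans[OF that(1) WB(1)] that(2) subset_trans[OF that(3) WB(2)] that(4,5)])
    show "q u v = q v u" for u v by (rule q)
  qed
  have delete: "\<exists>X :: 'a \<Rightarrow> bit ^ 5. dot_assignment A (V - K) p X" if "K \<subseteq> V" "K \<noteq> {}" for K
  proof -
    have "\<exists>X :: 'a \<Rightarrow> bit ^ 5. dot_assignment (A \<inter> (V - K) \<times> (V - K)) (V - K) p X"
      using that sym_arcs p by (intro smaller) (auto simp: sym_def)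
    then show ?thesis unfolding dot_assignment_def by blast
  qed
  show ?case
  proof (rule ccontr)
    assume none: "\<nexists>X :: 'a \<Rightarrow> bit ^ 5. dot_assignment A V p X"
    have "V \<noteq> {}"
    proof
      assume "V = {}"
      then have "dot_assignment A V p (\<lambda>_. 0 :: bit ^ 5)" by (simp add: dot_assignment_def)
      then show False using none by blast
    qed
    then have "3 * card A < 10 * card V" using sparse[of V A] arcs_subset sym_arcs by blast
    moreover have "10 * card V \<le> 3 * card A"
    proof (rule irreducible_dense)
      show "2 \<le> card (A `` {v})" if vV: "v \<in> V" for v
      proof (rule ccontr)
        assume "\<not> 2 \<le> card (A `` {v})"
        then have "card (A `` {v}) \<le> 1" by simp
        moreover obtain X :: "'a \<Rightarrow> bit ^ 5" where "dot_assignment A (V - {v}) p X"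
          using delete[of "{v}"] vV by blast
        ultimately show False using reduce_degree_le_1[where p = p, OF _ p vV] none by blast
      qed
    next
      fix v assume v: "v \<in> V" and ne: "A `` {v} \<inter> {v \<in> V. card (A `` {v}) = 2} \<noteq> {}"
      define K where "K = {t \<in> A `` {v}. card (A `` {t}) = 2}"
      have K: "K = A `` {v} \<inter> {v \<in> V. card (A `` {v}) = 2}" 
        "A `` {v} - K = A `` {v} - {v \<in> V. card (A `` {v}) = 2}"
        using arcD by (auto simp: K_def)
      obtain X :: "'a \<Rightarrow> bit ^ 5" where "dot_assignment A (V - K) p X"
        using delete[of K] ne K arcD by blast
      then have "\<not> 2 ^ card (A `` {v} - K) * (card K + 1) < (32 :: nat)"
        using reduce_degree_2_neighbours[of v p X, folded K_def] p tri v none by blast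
      then show "32 \<le> 2 ^ card (A `` {v} - {v \<in> V. card (A `` {v}) = 2}) *
          (card (A `` {v} \<inter> {v \<in> V. card (A `` {v}) = 2}) + 1)"
        using K by (simp add: not_less)
    next
      have False if uv: "(u, v) \<in> A" "card (A `` {u}) = 3" "card (A `` {v}) = 3" for u v
      proof -
        have "\<exists>X :: 'a \<Rightarrow> bit ^ 5. dot_assignment (A - {(u, v), (v, u)}) V q X"
          if "\<And>u v. q u v = q v u" for q
          using that uv arcs_subset sym_arcs by (intro smaller) (auto simp: sym_def)
        then show False using reduce_adjacent_degree_3[where p = p, OF uv p] none by blast
      qed
      then show "A \<inter> {v \<in> V. card (A `` {v}) = 3} \<times> {v \<in> V. card (A `` {v}) = 3} = {}" by blast
    qed
    ultimately show False by linarith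
  qed
qed

section \<open>Plane topology\<close>

lemma connected_subset_inside:
  assumes "connected T" "T \<inter> S = {}" "x \<in> T" "x \<in> inside S"
  shows "T \<subseteq> inside S"
proof
  fix y assume "y \<in> T"
  then have "connected_component (- S) x y"
    using assms unfolding connected_component_def by blast
  then show "y \<in> inside S" using assms(4) inside_same_component by blast
qed

lemma connected_subset_outside:
  assumes "connected T" "T \<inter> S = {}" "x \<in> T" "x \<in> outside S"
  shows "T \<subseteq> outside S"
proof
  fix y assume "y \<in> T"
  then have "connected_component (- S) x y"
    using assms unfolding connected_component_def by blast
  then show "y \<in> outside S" using assms(4) outside_same_component by blast
qed

text \<open>
  An arc is homeomorphic to an interval, from which any interior point can be removed to
  disconnect it, whereas a disc stays connected when a point is removed. This is needed to find a
  centre of inversion off a drawing; arcs may have positive area, so measure does not help.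
\<close>

lemma interior_arc_image_empty:
  fixes g :: "real \<Rightarrow> complex"
  assumes "Path_Connected.arc g"
  shows "interior (path_image g) = {}"
proof (rule ccontr)
  assume "interior (path_image g) \<noteq> {}"
  then obtain x r where r: "0 < r" "ball x r \<subseteq> path_image g"
    by (auto simp: mem_interior)
  obtain h where h: "homeomorphism {0..1} (path_image g) g h"
    using homeomorphism_arc[OF assms] .
  have cont: "continuous_on (ball x r - T) h" for T
    by (rule continuous_on_subset[OF homeomorphism_cont2[OF h]]) (use r(2) in blast)
  have gh: "g (h y) = y" if "y \<in> ball x r" for y
    using homeomorphism_apply2[OF h] r(2) that by blast
  let ?y = "x + of_real (r / 2)"
  have y: "x \<in> ball x r" "?y \<in> ball x r" "?y \<noteq> x" using r(1) by (auto simp: dist_norm)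
  then have ne: "h x \<noteq> h ?y" using gh by metis
  define m where "m = (h x + h ?y) / 2"
  have m: "m \<noteq> h x" "m \<noteq> h ?y" "m \<in> closed_segment (h x) (h ?y)"
    using ne by (auto simp: m_def field_simps closed_segment_eq_real_ivl)
  have seg: "closed_segment (h x) (h ?y) \<subseteq> h ` (ball x r - T)"
    if "connected (ball x r - T)" "x \<notin> T" "?y \<notin> T" for T
  proof -
    have "connected (h ` (ball x r - T))" using cont that(1) by (rule connected_continuous_image)
    then have "convex (h ` (ball x r - T))"
      using is_interval_connected_1 is_interval_convex_1 by blast
    moreover have "h x \<in> h ` (ball x r - T)" "h ?y \<in> h ` (ball x r - T)"
      using y that by blast+
    ultimately show ?thesis unfolding convex_contains_segment by blast
  qed
  obtain z where z: "z \<in> ball x r" "h z = m"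
    using seg[of "{}"] m(3) by auto
  have "connected (ball x r - {z})" by (intro connected_open_delete) auto
  moreover have "x \<notin> {z}" "?y \<notin> {z}" using z m by blast+
  ultimately have "m \<in> h ` (ball x r - {z})" using seg[of "{z}"] m(3) by blast
  then obtain w where "w \<in> ball x r - {z}" "h w = m" by blast
  then show False using gh z by (metis DiffD1 DiffD2 singletonI)
qed

lemma interior_finite_Union_arcs_empty:
  fixes \<G> :: "(real \<Rightarrow> complex) set"
  assumes "finite \<G>" "\<And>g. g \<in> \<G> \<Longrightarrow> Path_Connected.arc g"
  shows "interior (\<Union>g\<in>\<G>. path_image g) = {}"
  using assms
proof (induction rule: finite_induct)
  case (insert g \<G>)
  have "interior (path_image g \<union> (\<Union>g\<in>\<G>. path_image g)) = interior (path_image g)"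
    using insert by (intro interior_closed_Un_empty_interior closed_arc_image) auto
  then show ?case using insert.prems interior_arc_image_empty by simp
qed simp

text \<open>
  Near the centre \<open>z\<^sub>0\<close> the inversion is unbounded. So the image of the inside is connected and
  unbounded, hence lies outside the image curve. Conversely, if some point of the outside were mapped to
  the outside of the image curve, then pulling back this unbounded connected region would join
  that point to points near \<open>z\<^sub>0\<close> without crossing the curve.
\<close>

lemma inversion_swaps_sides:
  fixes c :: "real \<Rightarrow> complex"
  assumes c: "simple_path c" "pathfinish c = pathstart c"
    and z0: "z0 \<in> inside (path_image c)"
  defines "f \<equiv> \<lambda>z. inverse (z - z0)"
  shows "p \<in> outside (path_image c) \<Longrightarrow> f p \<in> inside (f ` path_image c)"
    and "p \<in> inside (path_image c) \<Longrightarrow> p \<noteq> z0 \<Longrightarrow> f p \<notin> inside (f ` path_image c)"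
proof -
  let ?S = "path_image c" and ?T = "f ` path_image c"
  have z0S: "z0 \<notin> ?S" using z0 inside_no_overlap by blast
  have inj: "f x = f y \<Longrightarrow> x = y" for x y by (simp add: f_def)
  have contf: "continuous_on X f" if "z0 \<notin> X" for X
    using that unfolding f_def by (intro continuous_intros) auto
  have "simple_path (f \<circ> c)" "pathfinish (f \<circ> c) = pathstart (f \<circ> c)"
    using c contf[OF z0S] inj
    by (auto intro!: simple_path_continuous_image simp: inj_on_def pathfinish_compose pathstart_compose)
  note JT = Jordan_inside_outside[OF this, unfolded path_image_compose]
  note JS = Jordan_inside_outside[OF c]
  obtain e where e: "0 < e" "ball z0 e \<subseteq> inside ?S"
    using JS z0 open_contains_ball by metis

  have f_in: "f p \<notin> inside ?T" if p: "p \<in> inside ?S" "p \<noteq> z0" for p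
  proof
    assume fp: "f p \<in> inside ?T"
    have "connected (f ` (inside ?S - {z0}))"
      using JS by (intro connected_continuous_image contf connected_open_delete) auto
    moreover have "f ` (inside ?S - {z0}) \<inter> ?T = {}"
      using inj inside_no_overlap by blast
    ultimately have sub: "f ` (inside ?S - {z0}) \<subseteq> inside ?T"
      using p fp connected_subset_inside[of "f ` (inside ?S - {z0})" ?T "f p"] by blast
    have "bounded (inside ?T)" using JT by blast
    then obtain M where M: "0 < M" "\<And>w. w \<in> inside ?T \<Longrightarrow> norm w \<le> M"
      unfolding bounded_pos by blast
    \<comment> \<open>at this distance from the centre the inversion exceeds the bound \<open>M\<close>\<close>
    define d where "d = min (e / 2) (1 / (2 * M))"
    have d: "0 < d" "d < e" "d * M < 1"
      using e M by (auto simp: d_def min_def field_simps)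
    then have "z0 + of_real d \<in> ball z0 e" "z0 + of_real d \<noteq> z0" by (auto simp: dist_norm)
    then have "z0 + of_real d \<in> inside ?S - {z0}" using e(2) by blast
    then have "norm (f (z0 + of_real d)) \<le> M" using sub M by blast
    then have "inverse d \<le> M" using d(1) by (simp add: f_def norm_inverse)
    then show False using d(1,3) by (simp add: field_simps)
  qed
  then show "p \<in> inside ?S \<Longrightarrow> p \<noteq> z0 \<Longrightarrow> f p \<notin> inside ?T" by blast

  show "f p \<in> inside ?T" if p: "p \<in> outside ?S"
  proof (rule ccontr)
    assume np: "f p \<notin> inside ?T"
    have pS: "p \<notin> ?S" "p \<noteq> z0" using p z0 outside_no_overlap JS by blast+
    then have "f p \<notin> ?T" using inj by blast
    with np JT have fp: "f p \<in> outside ?T" by blast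
    define W where "W = outside ?T - {0}"
    define g where "g = (\<lambda>w. z0 + inverse w)"
    have fg: "f (g w) = w" for w by (simp add: f_def g_def)
    have gf: "g (f x) = x" for x by (simp add: f_def g_def)
    have "connected (g ` W)"
      unfolding W_def g_def using JT
      by (intro connected_continuous_image connected_open_delete continuous_intros) auto
    moreover have "g ` W \<inter> ?S = {}"
    proof -
      have False if w: "w \<in> outside ?T" "g w \<in> ?S" for w
      proof -
        have "w \<in> ?T" using w(2) fg[of w] by (metis imageI)
        then show False using w(1) outside_no_overlap by blast
      qed
      then show ?thesis unfolding W_def by blast
    qed
    moreover have "p \<in> g ` W"
      using fp pS gf by (intro image_eqI[of _ _ "f p"]) (auto simp: W_def f_def)
    ultimately have sub: "g ` W \<subseteq> outside ?S"
      using p by (rule connected_subset_outside)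
    have "\<not> bounded (outside ?T)" using JT by blast
    then obtain w where w: "w \<in> outside ?T" "\<not> norm w \<le> inverse e"
      unfolding bounded_iff by blast
    then have nw: "inverse e < norm w" "0 < norm w" using e by (auto simp: not_le intro: less_trans[of 0 "inverse e"])
    then have "inverse (norm w) < inverse (inverse e)" using e by (intro less_imp_inverse_less) auto
    then have "norm (inverse w) < e" by (simp add: norm_inverse)
    then have "g w \<in> ball z0 e" by (simp add: g_def dist_norm)
    then have "g w \<in> inside ?S" using e(2) by blast
    moreover have "g w \<in> outside ?S" using sub w nw by (auto simp: W_def)
    ultimately show False using JS by blast
  qed
qed

section \<open>Paths, cycles and ears\<close>

text \<open>
  Both arcs of every edge are included, so that these sets are symmetric and count edges twice.
\<close>

fun path_arcs :: "'a list \<Rightarrow> 'a rel" where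
  "path_arcs (x # y # zs) = {(x, y), (y, x)} \<union> path_arcs (y # zs)"
| "path_arcs _ = {}"

lemma finite_path_arcs [simp]: "finite (path_arcs xs)"
  by (induction xs rule: path_arcs.induct) auto

lemma sym_path_arcs [simp]: "sym (path_arcs xs)"
  by (induction xs rule: path_arcs.induct) (auto simp: sym_def)

lemma path_arcs_subset: "path_arcs xs \<subseteq> set xs \<times> set xs"
  by (induction xs rule: path_arcs.induct) auto

lemma path_arcs_append: "path_arcs (xs @ y # ys) = path_arcs (xs @ [y]) \<union> path_arcs (y # ys)"
  by (induction xs rule: path_arcs.induct) auto

lemma path_arcs_snoc: "path_arcs (xs @ [x, y]) = path_arcs (xs @ [x]) \<union> {(x, y), (y, x)}"
  by (subst path_arcs_append) simp

lemma path_arcs_rev [simp]: "path_arcs (rev xs) = path_arcs xs"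
  by (induction xs rule: path_arcs.induct) (auto simp: path_arcs_snoc)

lemma card_path_arcs: "distinct xs \<Longrightarrow> card (path_arcs xs) = 2 * (length xs - 1)"
proof (induction xs rule: path_arcs.induct)
  case (1 x y zs)
  have "{(x, y), (y, x)} \<inter> path_arcs (y # zs) = {}"
    using 1(2) path_arcs_subset[of "y # zs"] by auto
  then have "card (path_arcs (x # y # zs)) = card {(x, y), (y, x)} + card (path_arcs (y # zs))"
    unfolding path_arcs.simps by (intro card_Un_disjoint) auto
  moreover have "card {(x, y), (y, x)} = 2" using 1(2) by auto
  ultimately show ?case using 1 by simp
qed auto

text \<open>
  A path with more than one edge does not use the edge between its ends. This is what keeps two
  internally disjoint paths with the same ends edge-disjoint, unless both are a single edge.
\<close>

lemma path_arcs_chord: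
  assumes "distinct (a # ys @ [b])" "(a, b) \<in> path_arcs (a # ys @ [b])"
  shows "ys = []"
proof (cases ys)
  case (Cons y zs)
  then show ?thesis using assms path_arcs_subset[of "y # zs @ [b]"] by auto
qed

text \<open>
  Reachability yields a path without repeated vertices: the path is extended step by step, and cut
  back whenever the next vertex is already on it.
\<close>

lemma path_between:
  assumes "(p, q) \<in> R\<^sup>*" "sym R"
  obtains ws where "distinct (p # ws)" "last (p # ws) = q" "path_arcs (p # ws) \<subseteq> R"
    "set (p # ws) \<subseteq> R\<^sup>* `` {p}"
  using assms(1)
proof (induction arbitrary: thesis rule: rtrancl_induct)
  case base
  show ?case by (rule base[of "[]"]) auto
next
  case (step q r)
  obtain ws where ws: "distinct (p # ws)" "last (p # ws) = q" "path_arcs (p # ws) \<subseteq> R"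
    "set (p # ws) \<subseteq> R\<^sup>* `` {p}" using step.IH .
  show ?case
  proof (cases "r \<in> set (p # ws)")
    case True
    then obtain us vs where uv: "p # ws = us @ r # vs" by (meson split_list)
    then obtain ts where ts: "us @ [r] = p # ts" by (cases us) auto
    have "path_arcs (us @ [r]) \<subseteq> R" using ws(3) unfolding uv by (subst (asm) path_arcs_append) simp
    moreover have "distinct (us @ [r])" using ws(1) unfolding uv by simp
    moreover have "set (us @ [r]) \<subseteq> R\<^sup>* `` {p}" using ws(4) unfolding uv by simp
    moreover have "last (p # ts) = r" using ts by (metis last_snoc)
    ultimately show ?thesis unfolding ts by (intro step.prems)
  next
    case False
    obtain us where us: "p # ws = us @ [q]" using ws(2) by (metis append_butlast_last_id list.discI)
    have "path_arcs (p # ws @ [r]) = path_arcs (us @ [q, r])"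
      using us by (metis append.assoc append_Cons append_Nil)
    also have "\<dots> \<subseteq> R" using ws(3) us step.hyps(2) assms(2)
      by (auto simp: path_arcs_snoc dest: symD)
    finally have "path_arcs (p # ws @ [r]) \<subseteq> R" .
    moreover have "(p, r) \<in> R\<^sup>*" using step.hyps by auto
    ultimately show ?thesis using ws False by (intro step.prems[of "ws @ [r]"]) auto
  qed
qed

definition cycle_arcs :: "'a list \<Rightarrow> 'a rel" where
  "cycle_arcs xs = path_arcs (xs @ [hd xs])"

definition is_cycle :: "'a rel \<Rightarrow> 'a list \<Rightarrow> bool" where
  "is_cycle A xs \<longleftrightarrow> distinct xs \<and> 3 \<le> length xs \<and> cycle_arcs xs \<subseteq> A"

lemma cycle_arcs_subset: "xs \<noteq> [] \<Longrightarrow> cycle_arcs xs \<subseteq> set xs \<times> set xs"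
  using path_arcs_subset[of "xs @ [hd xs]"] by (auto simp: cycle_arcs_def)

lemma card_cycle_arcs:
  assumes "distinct xs" "3 \<le> length xs"
  shows "card (cycle_arcs xs) = 2 * length xs"
proof -
  obtain a ys b where xs: "xs = a # ys @ [b]" "ys \<noteq> []"
    using assms(2) by (cases xs; cases "tl xs" rule: rev_cases) fastforce+
  have c: "cycle_arcs xs = path_arcs xs \<union> {(b, a), (a, b)}"
    using path_arcs_snoc[of "a # ys" b a] by (simp add: cycle_arcs_def xs)
  have "(a, b) \<notin> path_arcs xs" using path_arcs_chord[of a ys b] assms(1) xs by blast
  moreover from this have "(b, a) \<notin> path_arcs xs" using sym_path_arcs symD by metis
  ultimately have "card (cycle_arcs xs) = card (path_arcs xs) + card {(b, a), (a, b)}"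
    unfolding c by (intro card_Un_disjoint) auto
  moreover have "card {(b, a), (a, b)} = 2" using assms(1) xs by auto
  ultimately show ?thesis using card_path_arcs[OF assms(1)] assms(2) by simp
qed

lemma path_arcs_cover: "2 \<le> length xs \<Longrightarrow> x \<in> set xs \<Longrightarrow> \<exists>y. (x, y) \<in> path_arcs xs"
proof (induction xs rule: path_arcs.induct)
  case (1 u v zs)
  then show ?case by (cases zs) auto
qed auto

lemma cycle_arcs_cover: "xs \<noteq> [] \<Longrightarrow> x \<in> set xs \<Longrightarrow> \<exists>y. (x, y) \<in> cycle_arcs xs"
  unfolding cycle_arcs_def by (rule path_arcs_cover) (cases xs; simp)+

text \<open>
  The next two lemmas translate between cycles and pairs of internally disjoint paths with common
  ends, the form in which the theta-curve theorem speaks of closed curves.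
\<close>

lemma cycle_join:
  assumes "distinct (a # b # ys @ zs)" "ys \<noteq> [] \<or> zs \<noteq> []"
    and "path_arcs (a # ys @ [b]) \<subseteq> A" "path_arcs (a # zs @ [b]) \<subseteq> A"
  obtains xs where "is_cycle A xs" "set xs = {a, b} \<union> set ys \<union> set zs"
    "length xs = length ys + length zs + 2"
    "cycle_arcs xs = path_arcs (a # ys @ [b]) \<union> path_arcs (a # zs @ [b])"
proof -
  let ?xs = "a # ys @ b # rev zs"
  have "cycle_arcs ?xs = path_arcs ((a # ys) @ b # rev zs @ [a])" by (simp add: cycle_arcs_def)
  also have "\<dots> = path_arcs ((a # ys) @ [b]) \<union> path_arcs (b # rev zs @ [a])"
    by (rule path_arcs_append)
  also have "path_arcs (b # rev zs @ [a]) = path_arcs (a # zs @ [b])"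
    using path_arcs_rev[of "a # zs @ [b]"] by simp
  finally have c: "cycle_arcs ?xs = path_arcs (a # ys @ [b]) \<union> path_arcs (a # zs @ [b])" by simp
  have "is_cycle A ?xs" unfolding is_cycle_def c using assms by (cases ys; cases zs) auto
  then show thesis using c by (intro that[of ?xs]) auto
qed

lemma cycle_split:
  assumes xs: "is_cycle A xs" and ab: "a \<in> set xs" "b \<in> set xs" "a \<noteq> b"
  obtains ys zs where "distinct (a # b # ys @ zs)" "ys \<noteq> [] \<or> zs \<noteq> []"
    "set xs = {a, b} \<union> set ys \<union> set zs" "length xs = length ys + length zs + 2"
    "cycle_arcs xs = path_arcs (a # ys @ [b]) \<union> path_arcs (a # zs @ [b])"
proof -
  have ordered: "\<exists>ys zs. distinct (c # d # ys @ zs) \<and>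
      set xs = {c, d} \<union> set ys \<union> set zs \<and> length xs = length ys + length zs + 2 \<and>
      cycle_arcs xs = path_arcs (c # ys @ [d]) \<union> path_arcs (c # zs @ [d])"
    if split: "xs = ps @ c # qs @ d # rs" for c d ps qs rs
  proof -
    have "cycle_arcs xs = path_arcs (ps @ c # (qs @ d # rs @ [hd xs]))"
      by (simp add: cycle_arcs_def split)
    also have "\<dots> = path_arcs (ps @ [c]) \<union> path_arcs ((c # qs) @ d # rs @ [hd xs])"
      by (subst path_arcs_append) simp
    also have "path_arcs ((c # qs) @ d # rs @ [hd xs]) =
        path_arcs (c # qs @ [d]) \<union> path_arcs (d # rs @ [hd xs])"
      by (subst path_arcs_append) simp
    also have "path_arcs (ps @ [c]) \<union> (path_arcs (c # qs @ [d]) \<union> path_arcs (d # rs @ [hd xs]))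
        = path_arcs (c # qs @ [d]) \<union> (path_arcs (d # rs @ [hd xs]) \<union> path_arcs (ps @ [c]))"
      by blast
    also have "path_arcs (d # rs @ [hd xs]) \<union> path_arcs (ps @ [c]) = path_arcs (d # rs @ ps @ [c])"
    proof (cases ps)
      case (Cons p ps')
      then show ?thesis using path_arcs_append[of "d # rs" p "ps' @ [c]"] by (simp add: split)
    qed (simp add: split)
    also have "\<dots> = path_arcs (c # rev (rs @ ps) @ [d])"
      using path_arcs_rev[of "d # rs @ ps @ [c]"] by simp
    finally show ?thesis using xs
      by (intro exI[of _ qs] exI[of _ "rev (rs @ ps)"]) (auto simp: is_cycle_def split)
  qed
  have ne: "ys \<noteq> [] \<or> zs \<noteq> []" if "length xs = length ys + length zs + 2" for ys zs :: "'a list"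
    using xs that by (auto simp: is_cycle_def)
  obtain ps ts where 1: "xs = ps @ a # ts" using split_list[OF ab(1)] by blast
  show thesis
  proof (cases "b \<in> set ts")
    case True
    then obtain qs rs where "ts = qs @ b # rs" using split_list by metis
    then have "xs = ps @ a # qs @ b # rs" using 1 by simp
    from ordered[OF this] show thesis using ne that by (elim exE conjE) blast
  next
    case False
    then have "b \<in> set ps" using 1 ab by auto
    then obtain us vs where "ps = us @ b # vs" using split_list by metis
    then have "xs = us @ b # vs @ a # ts" using 1 by simp
    from ordered[OF this] show thesis
    proof (elim exE conjE)
      fix ys zs
      assume o: "distinct (b # a # ys @ zs)" "set xs = {b, a} \<union> set ys \<union> set zs"
          "length xs = length ys + length zs + 2"
          "cycle_arcs xs = path_arcs (b # ys @ [a]) \<union> path_arcs (b # zs @ [a])"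
      have rev: "path_arcs (b # ws @ [a]) = path_arcs (a # rev ws @ [b])" for ws
        using path_arcs_rev[of "b # ws @ [a]"] by simp
      show thesis
      proof (rule that)
        show "distinct (a # b # rev ys @ rev zs)" using o(1) by auto
        show "rev ys \<noteq> [] \<or> rev zs \<noteq> []" using ne[OF o(3)] by simp
        show "set xs = {a, b} \<union> set (rev ys) \<union> set (rev zs)" unfolding o(2) set_rev by blast
        show "length xs = length (rev ys) + length (rev zs) + 2" using o(3) by simp
        show "cycle_arcs xs = path_arcs (a # rev ys @ [b]) \<union> path_arcs (a # rev zs @ [b])"
          using o(4) unfolding rev .
      qed
    qed
  qed
qed

lemma card_ge_2E:
  assumes "2 \<le> card S"
  obtains a b where "a \<in> S" "b \<in> S" "a \<noteq> b"
proof -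
  obtain T where "T \<subseteq> S" "card T = 2" using obtain_subset_with_card_n[OF assms] by metis
  then show thesis using that by (auto simp: card_2_iff)
qed

context fin_sgraph
begin

text \<open>
  The set \<open>A `` K - K\<close> consists of the vertices outside \<open>K\<close> with a neighbour in \<open>K\<close>. Asking for two
  of them is a form of 2-connectedness: a smaller attachment set would be a cut vertex
  or separate components, and the graph could be cut there. The condition on \<^term>\<open>V - K\<close> makes
  both parts smaller than the whole graph.
\<close>

definition two_connected :: bool where
  "two_connected \<longleftrightarrow> (\<forall>K \<subseteq> V. K \<noteq> {} \<longrightarrow> 2 \<le> card (V - K) \<longrightarrow> 2 \<le> card (A `` K - K))"

text \<open>
  The edges that remain when \<open>C\<close> is deleted. The component of a vertex \<open>x\<close> in the remaining graph is
  \<open>(avoiding C)\<^sup>* `` {x}\<close>.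
\<close>

definition avoiding :: "'a set \<Rightarrow> 'a rel" where
  "avoiding C = A \<inter> (V - C) \<times> (V - C)"

lemma sym_avoiding: "sym (avoiding C)"
  using sym_arcs by (auto simp: avoiding_def sym_def)

lemma avoiding_closure_subset: "x \<in> V - C \<Longrightarrow> (avoiding C)\<^sup>* `` {x} \<subseteq> V - C"
proof
  fix y assume x: "x \<in> V - C" and "y \<in> (avoiding C)\<^sup>* `` {x}"
  then have "(x, y) \<in> (avoiding C)\<^sup>*" by simp
  then show "y \<in> V - C" by cases (use x in \<open>auto simp: avoiding_def\<close>)
qed

lemma avoiding_closure_boundary:
  assumes "x \<in> V - C"
  shows "A `` ((avoiding C)\<^sup>* `` {x}) - (avoiding C)\<^sup>* `` {x} \<subseteq> C"
proof
  fix y assume y: "y \<in> A `` ((avoiding C)\<^sup>* `` {x}) - (avoiding C)\<^sup>* `` {x}"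
  then obtain k where k: "(x, k) \<in> (avoiding C)\<^sup>*" "(k, y) \<in> A" by blast
  have "k \<in> V - C" using avoiding_closure_subset[OF assms] k(1) by blast
  show "y \<in> C"
  proof (rule ccontr)
    assume "y \<notin> C"
    then have "(k, y) \<in> avoiding C"
      using k(2) \<open>k \<in> V - C\<close> arcD unfolding avoiding_def by blast
    then have "(x, y) \<in> (avoiding C)\<^sup>*" using k(1) by (rule rtrancl_into_rtrancl[rotated])
    then show False using y by blast
  qed
qed

text \<open>
  The component of \<open>x\<close> outside \<open>C\<close> has two attachment vertices, which lie in \<open>C\<close>; a path through
  the component joins them.
\<close>

lemma ear_exists:
  assumes conn: two_connected and C: "C \<subseteq> V" "2 \<le> card C" and x: "x \<in> V - C"
  obtains a b ws where "a \<in> C" "b \<in> C" "ws \<noteq> []" "distinct (a # ws @ [b])"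
    "set ws \<subseteq> (avoiding C)\<^sup>* `` {x}" "path_arcs (a # ws @ [b]) \<subseteq> A"
proof -
  define R where "R = avoiding C"
  define K where "K = R\<^sup>* `` {x}"
  have K: "K \<subseteq> V - C" "x \<in> K" using avoiding_closure_subset[OF x] by (auto simp: K_def R_def)
  have "card C \<le> card (V - K)"
    using K C finite_verts by (intro card_mono) auto
  then have "2 \<le> card (A `` K - K)"
    using conn K C(2) unfolding two_connected_def by (metis Diff_subset empty_iff order_trans)
  then obtain a b where ab: "a \<in> A `` K - K" "b \<in> A `` K - K" "a \<noteq> b"
    by (rule card_ge_2E)
  have att: "A `` K - K \<subseteq> C"
    unfolding K_def R_def by (rule avoiding_closure_boundary[OF x])
  obtain p q where pq: "p \<in> K" "(p, a) \<in> A" "q \<in> K" "(q, b) \<in> A" using ab by blast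
  have symR: "sym R" by (simp add: R_def sym_avoiding)
  have "(p, x) \<in> R\<^sup>*" using pq(1) symR unfolding K_def by (meson Image_singleton_iff symD sym_rtrancl)
  then have pq_R: "(p, q) \<in> R\<^sup>*" using pq(3) unfolding K_def by auto
  obtain ws where ws: "distinct (p # ws)" "last (p # ws) = q" "path_arcs (p # ws) \<subseteq> R"
    "set (p # ws) \<subseteq> R\<^sup>* `` {p}" using path_between[OF pq_R symR] .
  have wsK: "set (p # ws) \<subseteq> K" using ws(4) pq(1) unfolding K_def by auto
  obtain us where us: "p # ws = us @ [q]" using ws(2) by (metis append_butlast_last_id list.discI)
  have snoc: "(p # ws) @ [b] = us @ [q, b]" using us by simp
  have "path_arcs ((p # ws) @ [b]) = path_arcs (p # ws) \<union> {(q, b), (b, q)}"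
    by (metis path_arcs_snoc snoc us)
  then have ear: "path_arcs (a # (p # ws) @ [b])
      = {(a, p), (p, a)} \<union> (path_arcs (p # ws) \<union> {(q, b), (b, q)})" by simp
  have "path_arcs (p # ws) \<subseteq> A" using ws(3) by (simp add: R_def avoiding_def)
  moreover have "{(a, p), (p, a)} \<subseteq> A" "{(q, b), (b, q)} \<subseteq> A" using pq arcD by blast+
  ultimately have "path_arcs (a # (p # ws) @ [b]) \<subseteq> A" unfolding ear by (intro Un_least)
  moreover have "distinct (a # (p # ws) @ [b])" using ws(1) wsK ab by auto
  ultimately show thesis
    using that[of a b "p # ws"] att ab wsK unfolding K_def R_def by blast
qed

text \<open>
  A vertex \<open>u\<close> has two neighbours, and they lie in the same component of the graph without \<open>u\<close>, for
  otherwise \<open>u\<close> would be a cut vertex.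
\<close>

lemma two_connected_has_cycle:
  assumes conn: two_connected and V: "3 \<le> card V"
  obtains xs where "is_cycle A xs"
proof -
  obtain u where u: "u \<in> V" using V by fastforce
  have "2 \<le> card (V - {u})" using V u by simp
  then have "2 \<le> card (A `` {u} - {u})"
    using conn u unfolding two_connected_def by blast
  then obtain a b where ab: "a \<in> A `` {u} - {u}" "b \<in> A `` {u} - {u}" "a \<noteq> b"
    by (rule card_ge_2E)
  define R where "R = avoiding {u}"
  define K where "K = R\<^sup>* `` {a}"
  have aV: "a \<in> V - {u}" and bV: "b \<in> V - {u}" using ab arcD by blast+
  have K: "K \<subseteq> V - {u}" "a \<in> K" using avoiding_closure_subset[OF aV] by (auto simp: K_def R_def)
  have "b \<in> K"
  proof (rule ccontr)
    assume "b \<notin> K"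
    have "A `` K - K \<subseteq> {u}"
      unfolding K_def R_def by (rule avoiding_closure_boundary[OF aV])
    then have "card (A `` K - K) \<le> 1" using card_mono[of "{u}"] by simp
    moreover have "{u, b} \<subseteq> V - K" using u bV K \<open>b \<notin> K\<close> by auto
    then have "card {u, b} \<le> card (V - K)" using finite_verts by (intro card_mono) auto
    then have "2 \<le> card (V - K)" using bV by auto
    moreover have "K \<subseteq> V" "K \<noteq> {}" using K by blast+
    ultimately have "2 \<le> card (A `` K - K)" using conn unfolding two_connected_def by blast
    then show False using \<open>card (A `` K - K) \<le> 1\<close> by simp
  qed
  then have ab_R: "(a, b) \<in> R\<^sup>*" by (simp add: K_def)
  obtain ws where ws: "distinct (a # ws)" "last (a # ws) = b" "path_arcs (a # ws) \<subseteq> R"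
    "set (a # ws) \<subseteq> R\<^sup>* `` {a}" using path_between[OF ab_R] sym_avoiding R_def by blast
  obtain us where us: "a # ws = us @ [b]" using ws(2) by (metis append_butlast_last_id list.discI)
  have snoc: "(a # ws) @ [u] = us @ [b, u]" using us by simp
  have "path_arcs ((a # ws) @ [u]) = path_arcs (a # ws) \<union> {(b, u), (u, b)}"
    by (metis path_arcs_snoc snoc us)
  then have cycle: "cycle_arcs (u # a # ws)
      = {(u, a), (a, u)} \<union> (path_arcs (a # ws) \<union> {(b, u), (u, b)})" by (simp add: cycle_arcs_def)
  have "path_arcs (a # ws) \<subseteq> A" using ws(3) by (simp add: R_def avoiding_def)
  moreover have "{(u, a), (a, u)} \<subseteq> A" "{(b, u), (u, b)} \<subseteq> A" using ab arcD by blast+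
  ultimately have "cycle_arcs (u # a # ws) \<subseteq> A" unfolding cycle by (intro Un_least)
  moreover have "distinct (u # a # ws)" using ws(1,4) K unfolding K_def by auto
  moreover have "ws \<noteq> []" using ws(2) ab(3) by auto
  then have "3 \<le> length (u # a # ws)" by (cases ws) auto
  ultimately show thesis using that[of "u # a # ws"] by (simp add: is_cycle_def)
qed

end

section \<open>Graphs drawn in the plane\<close>

locale plane_graph = fin_sgraph V A for V :: "'a set" and A +
  fixes pos :: "'a \<Rightarrow> complex" and \<gamma> :: "'a \<times> 'a \<Rightarrow> real \<Rightarrow> complex"
  assumes inj_pos: "inj_on pos V"
    and arc_edge: "(u, v) \<in> A \<Longrightarrow> Path_Connected.arc (\<gamma> (u, v))"
    and start_edge: "(u, v) \<in> A \<Longrightarrow> pathstart (\<gamma> (u, v)) = pos u"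
    and finish_edge: "(u, v) \<in> A \<Longrightarrow> pathfinish (\<gamma> (u, v)) = pos v"
    and reverse_edge: "(u, v) \<in> A \<Longrightarrow> \<gamma> (v, u) = reversepath (\<gamma> (u, v))"
    and edge_verts: "(u, v) \<in> A \<Longrightarrow> path_image (\<gamma> (u, v)) \<inter> pos ` V = {pos u, pos v}"
    and edge_crossing: "e \<in> A \<Longrightarrow> e' \<in> A \<Longrightarrow> e' \<noteq> e \<Longrightarrow> e' \<noteq> prod.swap e \<Longrightarrow>
      path_image (\<gamma> e) \<inter> path_image (\<gamma> e') \<subseteq> pos ` V"
begin

definition drawn :: "'a rel \<Rightarrow> complex set" where
  "drawn F = (\<Union>e\<in>F. path_image (\<gamma> e))"

lemma drawn_Un: "drawn (F \<union> F') = drawn F \<union> drawn F'"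
  by (auto simp: drawn_def)

lemma ends_in_edge: "(u, v) \<in> A \<Longrightarrow> pos u \<in> path_image (\<gamma> (u, v)) \<and> pos v \<in> path_image (\<gamma> (u, v))"
  using edge_verts by blast

lemma edge_vertD: "(u, v) \<in> A \<Longrightarrow> w \<in> V \<Longrightarrow> pos w \<in> path_image (\<gamma> (u, v)) \<Longrightarrow> w = u \<or> w = v"
  using edge_verts[of u v] arcD[of u v] inj_onD[OF inj_pos] by blast

lemma vert_in_drawnD:
  assumes "w \<in> V" "pos w \<in> drawn F" "F \<subseteq> A" "F \<subseteq> W \<times> W"
  shows "w \<in> W"
proof -
  obtain u v where uv: "(u, v) \<in> F" "pos w \<in> path_image (\<gamma> (u, v))"
    using assms(2) by (auto simp: drawn_def)
  then have "w = u \<or> w = v" using edge_vertD assms(1,3) by blast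
  then show ?thesis using uv(1) assms(4) by blast
qed

lemma swap_in: "sym F \<Longrightarrow> prod.swap e \<in> F \<longleftrightarrow> e \<in> F"
  by (cases e) (auto dest: symD)

lemma drawn_Int:
  assumes "F \<subseteq> A" "F' \<subseteq> A" "sym F" "F \<inter> F' = {}" "F \<subseteq> W \<times> W" "F' \<subseteq> W' \<times> W'"
  shows "drawn F \<inter> drawn F' \<subseteq> pos ` (W \<inter> W')"
proof
  fix z assume "z \<in> drawn F \<inter> drawn F'"
  then obtain e e' where e: "e \<in> F" "e' \<in> F'" "z \<in> path_image (\<gamma> e)" "z \<in> path_image (\<gamma> e')"
    by (auto simp: drawn_def)
  have "e' \<noteq> e" "e' \<noteq> prod.swap e" using e(1,2) assms(3,4) swap_in by blast+
  then have "z \<in> pos ` V" using edge_crossing[of e e'] e assms(1,2) by blast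
  then obtain w where w: "w \<in> V" "z = pos w" by blast
  have "w \<in> W" "w \<in> W'"
    using vert_in_drawnD[OF w(1)] w(2) e assms unfolding drawn_def by blast+
  then show "z \<in> pos ` (W \<inter> W')" using w by blast
qed

lemma edge_image_commute: "(u, v) \<in> A \<Longrightarrow> path_image (\<gamma> (v, u)) = path_image (\<gamma> (u, v))"
  by (simp add: reverse_edge)

lemma closed_edge: "e \<in> A \<Longrightarrow> closed (path_image (\<gamma> e))"
  using arc_edge closed_arc_image by (cases e) auto

lemma closed_drawn: "F \<subseteq> A \<Longrightarrow> closed (drawn F)"
  unfolding drawn_def using finite_arcs closed_edge by (intro closed_UN) (auto intro: finite_subset)

lemma ends_in_drawn: "(u, v) \<in> F \<Longrightarrow> F \<subseteq> A \<Longrightarrow> pos u \<in> drawn F \<and> pos v \<in> drawn F"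
  using ends_in_edge unfolding drawn_def by blast

definition open_edge :: "'a \<times> 'a \<Rightarrow> complex set" where
  "open_edge e = path_image (\<gamma> e) - {pos (fst e), pos (snd e)}"

lemma open_edge:
  assumes "e \<in> A"
  shows "connected (open_edge e)" "open_edge e \<noteq> {}" "path_image (\<gamma> e) \<subseteq> closure (open_edge e)"
proof -
  obtain u v where e: "e = (u, v)" by (cases e)
  have a: "Path_Connected.arc (\<gamma> e)" and s: "simple_path (\<gamma> e)"
    using arc_edge assms arc_imp_simple_path unfolding e by blast+
  have o: "open_edge e = path_image (\<gamma> e) - {pathstart (\<gamma> e), pathfinish (\<gamma> e)}"
    using assms start_edge finish_edge unfolding open_edge_def e by simp
  show "connected (open_edge e)" unfolding o by (rule connected_simple_path_endless[OF s])
  show "open_edge e \<noteq> {}" unfolding o by (rule nonempty_simple_path_endless[OF s])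
  have "continuous_on (closure {0<..<1}) (\<gamma> e)"
    using a by (simp add: arc_def path_def)
  then have "\<gamma> e ` closure {0<..<1} \<subseteq> closure (\<gamma> e ` {0<..<1})"
    by (rule image_closure_subset) (auto intro: closure_subset[THEN subsetD])
  then show "path_image (\<gamma> e) \<subseteq> closure (open_edge e)"
    unfolding o simple_path_endless[OF s] by (simp add: path_image_def)
qed

lemma open_edge_avoids_drawn:
  assumes "e \<in> A" "F \<subseteq> A" "sym F" "e \<notin> F"
  shows "open_edge e \<inter> drawn F = {}"
proof -
  obtain u v where e: "e = (u, v)" by (cases e)
  have "drawn F \<inter> drawn {e} \<subseteq> pos ` (V \<inter> {u, v})"
    using assms arcs_subset by (intro drawn_Int) (auto simp: e)
  then show ?thesis unfolding open_edge_def e by (auto simp: drawn_def)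
qed

text \<open>
  A path of the graph is drawn as an arc. Ends are kept apart from the inner vertices in the list, so
  that the two ends of the drawn arc are visible in the statement.
\<close>

lemma path_drawing:
  assumes "distinct (a # ys @ [b])" "path_arcs (a # ys @ [b]) \<subseteq> A"
  obtains g where "Path_Connected.arc g" "pathstart g = pos a" "pathfinish g = pos b"
    "path_image g = drawn (path_arcs (a # ys @ [b]))"
  using assms
proof (induction ys arbitrary: a thesis)
  case Nil
  then have ab: "(a, b) \<in> A" by simp
  show ?case
  proof (rule Nil.prems(1))
    show "path_image (\<gamma> (a, b)) = drawn (path_arcs (a # [] @ [b]))"
      using edge_image_commute[OF ab] by (simp add: drawn_def)
  qed (use ab arc_edge start_edge finish_edge in auto)
next
  case (Cons y ys)
  have ay: "(a, y) \<in> A" using Cons.prems(3) by simp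
  obtain g where g: "Path_Connected.arc g" "pathstart g = pos y" "pathfinish g = pos b"
    "path_image g = drawn (path_arcs (y # ys @ [b]))"
    using Cons.IH[of y] Cons.prems(2,3) by auto
  have im: "path_image (\<gamma> (a, y)) = drawn {(a, y), (y, a)}"
    using edge_image_commute[OF ay] by (simp add: drawn_def)
  have "drawn {(a, y), (y, a)} \<inter> drawn (path_arcs (y # ys @ [b]))
      \<subseteq> pos ` ({a, y} \<inter> set (y # ys @ [b]))"
  proof (rule drawn_Int)
    show "{(a, y), (y, a)} \<inter> path_arcs (y # ys @ [b]) = {}"
      using path_arcs_subset[of "y # ys @ [b]"] Cons.prems(2) by auto
    show "path_arcs (y # ys @ [b]) \<subseteq> set (y # ys @ [b]) \<times> set (y # ys @ [b])"
      by (rule path_arcs_subset)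
  qed (use Cons.prems(3) in \<open>auto simp: sym_def\<close>)
  also have "\<dots> \<subseteq> {pos y}" using Cons.prems(2) by auto
  finally have "Path_Connected.arc (\<gamma> (a, y) +++ g)"
    using g ay arc_edge finish_edge im by (intro arc_join) auto
  moreover have "path_image (\<gamma> (a, y) +++ g) = drawn (path_arcs (a # (y # ys) @ [b]))"
    using g(2,4) finish_edge[OF ay] im by (simp add: path_image_join drawn_Un[symmetric])
  ultimately show ?case using start_edge[OF ay] g(3) by (intro Cons.prems(1)) auto
qed

lemma paths_meet_at_ends:
  assumes "distinct (a # b # ys @ zs)" "ys \<noteq> [] \<or> zs \<noteq> []"
    and "path_arcs (a # ys @ [b]) \<subseteq> A" "path_arcs (a # zs @ [b]) \<subseteq> A"
  shows "drawn (path_arcs (a # ys @ [b])) \<inter> drawn (path_arcs (a # zs @ [b])) = {pos a, pos b}"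
proof
  have disj: "path_arcs (a # ys @ [b]) \<inter> path_arcs (a # zs @ [b]) = {}"
  proof (rule ccontr)
    assume "\<not> ?thesis"
    then obtain s t where st: "(s, t) \<in> path_arcs (a # ys @ [b])" "(s, t) \<in> path_arcs (a # zs @ [b])"
      by auto
    then have ts: "(t, s) \<in> path_arcs (a # ys @ [b])" "(t, s) \<in> path_arcs (a # zs @ [b])"
      using sym_path_arcs symD by metis+
    have "{s, t} \<subseteq> set (a # ys @ [b]) \<inter> set (a # zs @ [b])"
      using st path_arcs_subset[of "a # ys @ [b]"] path_arcs_subset[of "a # zs @ [b]"] by blast
    also have "\<dots> \<subseteq> {a, b}" using assms(1) by auto
    finally have "s \<in> {a, b}" "t \<in> {a, b}" by auto
    moreover have "s \<noteq> t" using st(1) assms(3) arcD by blast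
    ultimately have "(a, b) \<in> path_arcs (a # ys @ [b])" "(a, b) \<in> path_arcs (a # zs @ [b])"
      using st ts by auto
    then have "ys = []" "zs = []"
      using path_arcs_chord[of a ys b] path_arcs_chord[of a zs b] assms(1) by auto
    then show False using assms(2) by simp
  qed
  have "drawn (path_arcs (a # ys @ [b])) \<inter> drawn (path_arcs (a # zs @ [b]))
      \<subseteq> pos ` (set (a # ys @ [b]) \<inter> set (a # zs @ [b]))"
    by (rule drawn_Int[OF assms(3,4) sym_path_arcs disj path_arcs_subset path_arcs_subset])
  also have "\<dots> \<subseteq> {pos a, pos b}" using assms(1) by auto
  finally show "drawn (path_arcs (a # ys @ [b])) \<inter> drawn (path_arcs (a # zs @ [b])) \<subseteq> {pos a, pos b}" .
  have ends: "pos a \<in> drawn (path_arcs (a # ws @ [b])) \<and> pos b \<in> drawn (path_arcs (a # ws @ [b]))"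
    if ws: "distinct (a # ws @ [b])" "path_arcs (a # ws @ [b]) \<subseteq> A" for ws
  proof -
    obtain g where "Path_Connected.arc g" "pathstart g = pos a" "pathfinish g = pos b"
      "path_image g = drawn (path_arcs (a # ws @ [b]))" using path_drawing[OF ws] .
    then show ?thesis by (metis pathstart_in_path_image pathfinish_in_path_image)
  qed
  show "{pos a, pos b} \<subseteq> drawn (path_arcs (a # ys @ [b])) \<inter> drawn (path_arcs (a # zs @ [b]))"
    using ends[of ys] ends[of zs] assms by auto
qed

lemma cycle_drawing:
  assumes "is_cycle A xs"
  obtains c where "simple_path c" "pathfinish c = pathstart c" "path_image c = drawn (cycle_arcs xs)"
proof -
  have d: "distinct xs" "3 \<le> length xs" and sub: "cycle_arcs xs \<subseteq> A" using assms by (auto simp: is_cycle_def)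
  obtain a b xs' where ab: "xs = a # b # xs'"
    using d(2) by (cases xs; cases "tl xs") auto
  then have "a \<in> set xs" "b \<in> set xs" "a \<noteq> b" using d by auto
  from cycle_split[OF assms this] obtain ys zs where
    yz: "distinct (a # b # ys @ zs)" "ys \<noteq> [] \<or> zs \<noteq> []"
      "cycle_arcs xs = path_arcs (a # ys @ [b]) \<union> path_arcs (a # zs @ [b])" .
  have sub': "path_arcs (a # ys @ [b]) \<subseteq> A" "path_arcs (a # zs @ [b]) \<subseteq> A"
    using sub yz(3) by auto
  obtain g where g: "Path_Connected.arc g" "pathstart g = pos a" "pathfinish g = pos b"
    "path_image g = drawn (path_arcs (a # ys @ [b]))" using path_drawing[OF _ sub'(1)] yz(1) by auto
  obtain h where h: "Path_Connected.arc h" "pathstart h = pos a" "pathfinish h = pos b"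
    "path_image h = drawn (path_arcs (a # zs @ [b]))" using path_drawing[OF _ sub'(2)] yz(1) by auto
  have meet: "path_image g \<inter> path_image h = {pos a, pos b}"
    using paths_meet_at_ends[OF yz(1,2) sub'] g(4) h(4) by simp
  have "simple_path (g +++ reversepath h)"
    using g h meet by (subst simple_path_join_loop_eq) (auto simp: arc_reversepath)
  moreover have "path_image (g +++ reversepath h) = drawn (cycle_arcs xs)"
    using g h yz(3) by (simp add: path_image_join drawn_Un)
  ultimately show thesis using g h by (intro that[of "g +++ reversepath h"]) auto
qed

text \<open>
  The interior of a cycle is split by an ear through it. The hypotheses on \<open>ys\<close>, \<open>zs\<close> and \<open>ws\<close> say that
  at most one of the three paths is a single edge.
\<close>

lemma theta_split:
  assumes dist: "distinct (a # b # ys @ zs @ ws)"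
    and ne: "ys \<noteq> [] \<or> zs \<noteq> []" "ys \<noteq> [] \<or> ws \<noteq> []" "zs \<noteq> [] \<or> ws \<noteq> []"
    and sub: "path_arcs (a # ys @ [b]) \<subseteq> A" "path_arcs (a # zs @ [b]) \<subseteq> A" "path_arcs (a # ws @ [b]) \<subseteq> A"
  defines "Y \<equiv> drawn (path_arcs (a # ys @ [b]))" and "Z \<equiv> drawn (path_arcs (a # zs @ [b]))"
    and "W \<equiv> drawn (path_arcs (a # ws @ [b]))"
  assumes meets: "W \<inter> inside (Y \<union> Z) \<noteq> {}"
  shows "inside (Y \<union> W) \<inter> inside (Z \<union> W) = {}"
    and "inside (Y \<union> W) \<union> inside (Z \<union> W) \<union> (W - {pos a, pos b}) = inside (Y \<union> Z)"
    and "Y \<inter> W = {pos a, pos b}" and "Z \<inter> W = {pos a, pos b}"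
proof -
  have "distinct (a # b # ys @ ws)" "distinct (a # b # zs @ ws)" "distinct (a # b # ys @ zs)"
    using dist by auto
  note meet = paths_meet_at_ends[OF this(3) ne(1) sub(1,2)] paths_meet_at_ends[OF this(1) ne(2) sub(1,3)]
    paths_meet_at_ends[OF this(2) ne(3) sub(2,3)]
  then show YW: "Y \<inter> W = {pos a, pos b}" and ZW: "Z \<inter> W = {pos a, pos b}"
    by (simp_all add: Y_def Z_def W_def)
  have YZ: "Y \<inter> Z = {pos a, pos b}" using meet by (simp add: Y_def Z_def)
  obtain g where g: "Path_Connected.arc g" "pathstart g = pos a" "pathfinish g = pos b" "path_image g = Y"
    unfolding Y_def using path_drawing[OF _ sub(1)] dist by auto
  obtain h where h: "Path_Connected.arc h" "pathstart h = pos a" "pathfinish h = pos b" "path_image h = Z"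
    unfolding Z_def using path_drawing[OF _ sub(2)] dist by auto
  obtain k where k: "Path_Connected.arc k" "pathstart k = pos a" "pathfinish k = pos b" "path_image k = W"
    unfolding W_def using path_drawing[OF _ sub(3)] dist by auto
  have "pos a \<noteq> pos b" using g by (metis arc_distinct_ends)
  from split_inside_simple_closed_curve[of g "pos a" "pos b" h k, unfolded g(4) h(4) k(4),
      OF arc_imp_simple_path[OF g(1)] g(2,3) arc_imp_simple_path[OF h(1)] h(2,3)
        arc_imp_simple_path[OF k(1)] k(2,3) this YZ YW ZW meets]
  show "inside (Y \<union> W) \<inter> inside (Z \<union> W) = {}"
    and "inside (Y \<union> W) \<union> inside (Z \<union> W) \<union> (W - {pos a, pos b}) = inside (Y \<union> Z)"
    by blast+
qed

end

section \<open>Sparsity of plane graphs of girth at least 5\<close>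

context plane_graph
begin

definition side_arcs :: "complex set \<Rightarrow> 'a rel" where
  "side_arcs S = {e \<in> A. path_image (\<gamma> e) \<subseteq> S \<union> inside S}"

definition side_verts :: "complex set \<Rightarrow> 'a set" where
  "side_verts S = {v \<in> V. pos v \<in> S \<union> inside S}"

lemma finite_side [simp]: "finite (side_arcs S)" "finite (side_verts S)"
  using finite_arcs finite_verts by (auto simp: side_arcs_def side_verts_def)

lemma arcs_in_side: "F \<subseteq> A \<Longrightarrow> drawn F \<subseteq> S \<union> inside S \<Longrightarrow> F \<subseteq> side_arcs S"
  unfolding side_arcs_def drawn_def by blast

text \<open>
  An edge whose relative interior avoids the curve stays on one side of it by connectedness; its
  ends, which may lie on the curve, are then in the closure of that side.
\<close>

lemma edge_in_side:
  assumes "e \<in> A" "closed S" "open_edge e \<inter> S = {}" "p \<in> open_edge e" "p \<in> inside S"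
  shows "e \<in> side_arcs S"
proof -
  have "open_edge e \<subseteq> inside S"
    using connected_subset_inside[OF open_edge(1)[OF assms(1)] assms(3-5)] .
  then have "closure (open_edge e) \<subseteq> S \<union> inside S"
    using closure_mono closure_inside_subset[OF assms(2)] by blast
  then show ?thesis using open_edge(3)[OF assms(1)] assms(1) unfolding side_arcs_def by blast
qed

lemma reach_in_side:
  assumes "F \<subseteq> A" "F \<subseteq> C \<times> C" "sym F" "pos x \<in> inside (drawn F)" "w \<in> (avoiding C)\<^sup>* `` {x}"
  shows "pos w \<in> inside (drawn F)"
proof -
  have "(x, w) \<in> (avoiding C)\<^sup>*" using assms(5) by simp
  then show ?thesis
  proof (induction rule: rtrancl_induct)
    case (step y z)
    then have yz: "(y, z) \<in> A" "y \<notin> C" "z \<notin> C" by (auto simp: avoiding_def)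
    have "drawn F \<inter> drawn {(y, z)} \<subseteq> pos ` (C \<inter> {y, z})"
      using yz assms(1-3) by (intro drawn_Int) auto
    then have "path_image (\<gamma> (y, z)) \<inter> drawn F = {}" using yz by (auto simp: drawn_def)
    moreover have "connected (path_image (\<gamma> (y, z)))"
      using arc_edge[OF yz(1)] by (simp add: arc_imp_path connected_path_image)
    ultimately have "path_image (\<gamma> (y, z)) \<subseteq> inside (drawn F)"
      using step.IH ends_in_edge[OF yz(1)] connected_subset_inside by blast
    then show ?case using ends_in_edge[OF yz(1)] by blast
  qed (rule assms(4))
qed

text \<open>
  The ear comes either from the edge \<open>e\<close> itself, if it joins two vertices of the cycle, or from the
  component of an end of \<open>e\<close> off the cycle, all of which lies inside. For the theta-curve theorem it
  is enough that one point of the ear is inside.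
\<close>

lemma ear_in_side:
  assumes conn: two_connected and xs: "is_cycle A xs"
    and e: "e \<in> side_arcs (drawn (cycle_arcs xs))" "e \<notin> cycle_arcs xs"
  obtains a b ws where "a \<in> set xs" "b \<in> set xs" "distinct (a # ws @ [b])" "set ws \<inter> set xs = {}"
    "path_arcs (a # ws @ [b]) \<subseteq> A" "path_arcs (a # ws @ [b]) \<inter> cycle_arcs xs = {}"
    "drawn (path_arcs (a # ws @ [b])) \<inter> inside (drawn (cycle_arcs xs)) \<noteq> {}"
proof -
  let ?F = "cycle_arcs xs" and ?S = "drawn (cycle_arcs xs)"
  have xs': "distinct xs" "3 \<le> length xs" "?F \<subseteq> A" "xs \<noteq> []" using xs by (auto simp: is_cycle_def)
  have symF: "sym ?F" by (simp add: cycle_arcs_def)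
  have Fxs: "?F \<subseteq> set xs \<times> set xs" using cycle_arcs_subset xs'(4) .
  have xsV: "set xs \<subseteq> V" using cycle_arcs_cover[OF xs'(4)] xs'(3) arcD by blast
  obtain u v where uv: "e = (u, v)" by (cases e)
  have uvA: "(u, v) \<in> A" and im: "path_image (\<gamma> (u, v)) \<subseteq> ?S \<union> inside ?S"
    using e(1) uv by (auto simp: side_arcs_def)
  show thesis
  proof (cases "u \<in> set xs \<and> v \<in> set xs")
    case True
    obtain p where p: "p \<in> open_edge (u, v)" using open_edge(2)[OF uvA] by blast
    have "p \<notin> ?S" using open_edge_avoids_drawn[OF uvA xs'(3) symF] e(2) uv p by blast
    then have "p \<in> path_image (\<gamma> (u, v)) \<inter> inside ?S" using p im by (auto simp: open_edge_def)
    then have "drawn (path_arcs (u # [] @ [v])) \<inter> inside ?S \<noteq> {}" by (auto simp: drawn_def)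
    moreover have "path_arcs (u # [] @ [v]) \<inter> ?F = {}" using e(2) uv symF by (auto dest: symD)
    moreover have "path_arcs (u # [] @ [v]) \<subseteq> A" "distinct (u # [] @ [v])" using uvA arcD[OF uvA] by auto
    ultimately show thesis using True by (intro that[of u v "[]"]) auto
  next
    case False
    then obtain x where x: "x \<in> V - set xs" "pos x \<in> path_image (\<gamma> (u, v))"
      using arcD[OF uvA] ends_in_edge[OF uvA] by blast
    have "pos x \<notin> ?S" using vert_in_drawnD[OF _ _ xs'(3) Fxs] x(1) by blast
    then have px: "pos x \<in> inside ?S" using x(2) im by blast
    have "2 \<le> card (set xs)" using xs'(1,2) by (simp add: distinct_card)
    from ear_exists[OF conn xsV this x(1)] obtain a b ws where
      w: "a \<in> set xs" "b \<in> set xs" "ws \<noteq> []" "distinct (a # ws @ [b])"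
        "set ws \<subseteq> (avoiding (set xs))\<^sup>* `` {x}" "path_arcs (a # ws @ [b]) \<subseteq> A" .
    have disj: "set ws \<inter> set xs = {}" using w(5) avoiding_closure_subset[OF x(1)] by blast
    have "path_arcs (a # ws @ [b]) \<inter> ?F = {}"
    proof (rule ccontr)
      assume "\<not> ?thesis"
      then obtain s t where st: "(s, t) \<in> path_arcs (a # ws @ [b])" "(s, t) \<in> ?F" by auto
      have "{s, t} \<subseteq> set (a # ws @ [b]) \<inter> set xs"
        using st path_arcs_subset[of "a # ws @ [b]"] Fxs by blast
      also have "\<dots> \<subseteq> {a, b}" using disj by auto
      finally have "s \<in> {a, b}" "t \<in> {a, b}" by auto
      moreover have "s \<noteq> t" using st(1) w(6) arcD by blast
      moreover have "(t, s) \<in> path_arcs (a # ws @ [b])" using st(1) sym_path_arcs symD by metis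
      ultimately have "(a, b) \<in> path_arcs (a # ws @ [b])" using st(1) by auto
      then show False using path_arcs_chord[OF w(4)] w(3) by blast
    qed
    moreover have "pos (hd ws) \<in> drawn (path_arcs (a # ws @ [b]))"
    proof -
      have "(a, hd ws) \<in> path_arcs (a # ws @ [b])" using w(3) by (cases ws) auto
      then show ?thesis using ends_in_drawn w(6) by blast
    qed
    moreover have "pos (hd ws) \<in> inside ?S"
      using reach_in_side[OF xs'(3) Fxs symF px] w(3,5) hd_in_set by blast
    ultimately show thesis using that[OF w(1,2,4) disj w(6)] by blast
  qed
qed

text \<open>
  The two halves of a split interior play symmetric roles; \<open>Y\<close> and \<open>Z\<close> are the two parts of the cycle
  with ends \<open>p\<close> and \<open>q\<close>, and \<open>W\<close> is the ear. An edge on \<open>Z\<close> is lost in the half bounded by \<open>Y\<close>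
  and \<open>W\<close>, so the induction on the number of arcs proceeds.
\<close>

lemma half_side_psubset:
  assumes sub: "inside (Y \<union> W) \<subseteq> inside (Y \<union> Z)" "W - {p, q} \<subseteq> inside (Y \<union> Z)" "p \<in> Y" "q \<in> Y"
    and meet: "Y \<inter> Z = {p, q}" "Z \<inter> W = {p, q}" "p \<in> pos ` V" "q \<in> pos ` V"
    and e: "e \<in> A" "path_image (\<gamma> e) \<subseteq> Z"
  shows "side_arcs (Y \<union> W) \<subset> side_arcs (Y \<union> Z)" "side_verts (Y \<union> W) \<subseteq> side_verts (Y \<union> Z)"
proof -
  have region: "(Y \<union> W) \<union> inside (Y \<union> W) \<subseteq> (Y \<union> Z) \<union> inside (Y \<union> Z)" using sub by blast
  then show "side_verts (Y \<union> W) \<subseteq> side_verts (Y \<union> Z)" unfolding side_verts_def by blast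
  have Z: "Z \<inter> ((Y \<union> W) \<union> inside (Y \<union> W)) \<subseteq> {p, q}"
    using meet sub(1) inside_no_overlap[of "Y \<union> Z"] by blast
  obtain x where x: "x \<in> open_edge e" using open_edge(2)[OF e(1)] by blast
  have "x \<notin> pos ` V" using x edge_verts[of "fst e" "snd e"] e(1) by (auto simp: open_edge_def)
  then have "x \<notin> {p, q}" using meet(3,4) by blast
  then have "e \<notin> side_arcs (Y \<union> W)" using x Z e(2) by (auto simp: side_arcs_def open_edge_def)
  moreover have "e \<in> side_arcs (Y \<union> Z)" using e by (auto simp: side_arcs_def)
  moreover have "side_arcs (Y \<union> W) \<subseteq> side_arcs (Y \<union> Z)" using region unfolding side_arcs_def by blast
  ultimately show "side_arcs (Y \<union> W) \<subset> side_arcs (Y \<union> Z)" by blast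
qed

end

text \<open>
  Here \<open>p\<close> is the number of edges of the ear, which is shared by the two halves along with its
  \<open>p + 1\<close> vertices, and \<open>l\<close>, \<open>l1\<close>, \<open>l2\<close> are cycle lengths. As arcs count edges twice, the
  inequality says \<open>3 e + 5 + l \<le> 5 n\<close> for \<open>e\<close> edges and \<open>n\<close> vertices.
\<close>

lemma Euler_glue:
  fixes \<alpha> \<alpha>1 \<alpha>2 \<nu> \<nu>1 \<nu>2 l l1 l2 p :: nat
  assumes "\<alpha> + 2 * p \<le> \<alpha>1 + \<alpha>2" "\<nu>1 + \<nu>2 \<le> \<nu> + p + 1" "l1 + l2 = l + 2 * p"
    and "3 * \<alpha>1 + 10 + 2 * l1 \<le> 10 * \<nu>1" "3 * \<alpha>2 + 10 + 2 * l2 \<le> 10 * \<nu>2"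
  shows "3 * \<alpha> + 10 + 2 * l \<le> 10 * \<nu>"
  using assms by linarith

context plane_graph
begin

text \<open>
  This is Euler's formula combined with the fact that all inner faces have length at least 5: with
  \<open>f\<close> inner faces, \<open>e - n + 1 = f\<close> and \<open>5 f + l \<le> 2 e\<close> give the bound. An empty cycle satisfies it
  because \<open>l \<ge> 5\<close>, and splitting the inside by an ear preserves it.
\<close>

lemma side_sparse:
  assumes conn: two_connected and girth5: "\<And>xs. is_cycle A xs \<Longrightarrow> 5 \<le> length xs"
    and "is_cycle A xs"
  shows "3 * card (side_arcs (drawn (cycle_arcs xs))) + 10 + 2 * length xs
    \<le> 10 * card (side_verts (drawn (cycle_arcs xs)))"
  using assms(3)
proof (induction "card (side_arcs (drawn (cycle_arcs xs)))" arbitrary: xs rule: less_induct)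
  case (less xs)
  let ?S = "drawn (cycle_arcs xs)"
  have xs: "distinct xs" "3 \<le> length xs" "cycle_arcs xs \<subseteq> A" "xs \<noteq> []"
    using less.prems by (auto simp: is_cycle_def)
  have cycle_side: "cycle_arcs xs \<subseteq> side_arcs ?S" using xs(3) by (intro arcs_in_side) auto
  show ?case
  proof (cases "side_arcs ?S \<subseteq> cycle_arcs xs")
    case True
    then have "card (side_arcs ?S) = 2 * length xs"
      using cycle_side card_cycle_arcs xs(1,2) by (metis subset_antisym)
    moreover have "set xs \<subseteq> side_verts ?S"
    proof
      fix x assume "x \<in> set xs"
      then obtain y where y: "(x, y) \<in> cycle_arcs xs" using cycle_arcs_cover[OF xs(4)] by blast
      then have "pos x \<in> ?S" using ends_in_drawn xs(3) by blast
      moreover have "x \<in> V" using y xs(3) arcD by blast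
      ultimately show "x \<in> side_verts ?S" by (simp add: side_verts_def)
    qed
    then have "length xs \<le> card (side_verts ?S)"
      using card_mono[of "side_verts ?S" "set xs"] xs(1) by (simp add: distinct_card)
    ultimately show ?thesis using girth5[OF less.prems] by simp
  next
    case False
    then obtain e where "e \<in> side_arcs ?S" "e \<notin> cycle_arcs xs" by blast
    from ear_in_side[OF conn less.prems this] obtain a b ws where
      ear: "a \<in> set xs" "b \<in> set xs" "distinct (a # ws @ [b])" "set ws \<inter> set xs = {}"
        "path_arcs (a # ws @ [b]) \<subseteq> A" "path_arcs (a # ws @ [b]) \<inter> cycle_arcs xs = {}"
        "drawn (path_arcs (a # ws @ [b])) \<inter> inside ?S \<noteq> {}" .
    have "a \<noteq> b" using ear(3) by auto
    from cycle_split[OF less.prems ear(1,2) this] obtain ys zs where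
      yz: "distinct (a # b # ys @ zs)" "ys \<noteq> [] \<or> zs \<noteq> []" "set xs = {a, b} \<union> set ys \<union> set zs"
        "length xs = length ys + length zs + 2"
        "cycle_arcs xs = path_arcs (a # ys @ [b]) \<union> path_arcs (a # zs @ [b])" .
    let ?Y = "path_arcs (a # ys @ [b])" and ?Z = "path_arcs (a # zs @ [b])"
      and ?W = "path_arcs (a # ws @ [b])"
    have sub: "?Y \<subseteq> A" "?Z \<subseteq> A" "?W \<subseteq> A" using yz(5) xs(3) ear(5) by auto
    have dist: "distinct (a # b # ys @ zs @ ws)" using yz(1,3) ear(3,4) by auto
    have ne: "ys \<noteq> [] \<or> ws \<noteq> []" "zs \<noteq> [] \<or> ws \<noteq> []"
      using ear(6) unfolding yz(5) by auto
    define Y Z W where "Y = drawn ?Y" and "Z = drawn ?Z" and "W = drawn ?W"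
    have S: "?S = Y \<union> Z" by (simp add: yz(5) drawn_Un Y_def Z_def)
    have meets: "W \<inter> inside (Y \<union> Z) \<noteq> {}" using ear(7) S W_def by simp
    note split = theta_split[OF dist yz(2) ne sub meets[unfolded Y_def Z_def W_def],
        folded Y_def Z_def W_def]
    have YZ: "Y \<inter> Z = {pos a, pos b}"
      unfolding Y_def Z_def using yz(1,2) sub by (intro paths_meet_at_ends)
    have ZY: "Z \<inter> Y = {pos a, pos b}" using YZ by blast
    have abV: "pos a \<in> pos ` V" "pos b \<in> pos ` V"
      using ear(1,2) cycle_arcs_cover[OF xs(4)] xs(3) arcD by blast+
    have YW_sub: "inside (Y \<union> W) \<subseteq> inside (Y \<union> Z)" and ZW_sub: "inside (Z \<union> W) \<subseteq> inside (Y \<union> Z)"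
      and W_sub: "W - {pos a, pos b} \<subseteq> inside (Y \<union> Z)"
      using split(2) by blast+
    have closed: "closed (Y \<union> W)" "closed (Z \<union> W)"
      using closed_drawn sub unfolding Y_def Z_def W_def by (auto intro: closed_Un)

    have d1: "distinct (a # b # ys @ ws)" and d2: "distinct (a # b # zs @ ws)"
      using dist by auto
    obtain xs1 where xs1: "is_cycle A xs1" "length xs1 = length ys + length ws + 2"
        "cycle_arcs xs1 = ?Y \<union> ?W"
      by (rule cycle_join[OF d1 ne(1) sub(1,3)]) (rule that)
    obtain xs2 where xs2: "is_cycle A xs2" "length xs2 = length zs + length ws + 2"
        "cycle_arcs xs2 = ?Z \<union> ?W"
      by (rule cycle_join[OF d2 ne(2) sub(2,3)]) (rule that)
    have S1: "drawn (cycle_arcs xs1) = Y \<union> W" and S2: "drawn (cycle_arcs xs2) = Z \<union> W"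
      by (simp_all add: xs1 xs2 drawn_Un Y_def Z_def W_def)

    obtain ey where ey: "ey \<in> ?Y" using path_arcs_cover[of "a # ys @ [b]" a] by auto
    obtain ez where ez: "ez \<in> ?Z" using path_arcs_cover[of "a # zs @ [b]" a] by auto
    have "path_image (\<gamma> ez) \<subseteq> Z" "path_image (\<gamma> ey) \<subseteq> Y" "ez \<in> A" "ey \<in> A"
      using ey ez sub unfolding Y_def Z_def drawn_def by blast+
    note half1 = half_side_psubset[OF YW_sub W_sub _ _ YZ split(4) abV this(3,1)]
      and half2 = half_side_psubset[OF ZW_sub[unfolded Un_commute[of Y]] W_sub[unfolded Un_commute[of Y]]
        _ _ ZY split(3) abV this(4,2)]
    have ab_YZ: "pos a \<in> Y" "pos b \<in> Y" "pos a \<in> Z" "pos b \<in> Z" using YZ by blast+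
    have side1: "side_arcs (Y \<union> W) \<subset> side_arcs (Y \<union> Z)" "side_verts (Y \<union> W) \<subseteq> side_verts (Y \<union> Z)"
      using half1 ab_YZ by blast+
    have side2: "side_arcs (Z \<union> W) \<subset> side_arcs (Y \<union> Z)" "side_verts (Z \<union> W) \<subseteq> side_verts (Y \<union> Z)"
      using half2 ab_YZ unfolding Un_commute[of Y] by blast+
    have IH1: "3 * card (side_arcs (Y \<union> W)) + 10 + 2 * length xs1 \<le> 10 * card (side_verts (Y \<union> W))"
      by (rule less.hyps[OF _ xs1(1), unfolded S1 S])
        (rule psubset_card_mono[OF finite_side(1) side1(1)])
    have IH2: "3 * card (side_arcs (Z \<union> W)) + 10 + 2 * length xs2 \<le> 10 * card (side_verts (Z \<union> W))"
      by (rule less.hyps[OF _ xs2(1), unfolded S2 S])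
        (rule psubset_card_mono[OF finite_side(1) side2(1)])

    \<comment> \<open>an edge off the theta curve runs in one of the two regions into which the ear cuts the inside\<close>
    have "side_arcs (Y \<union> Z) \<subseteq> side_arcs (Y \<union> W) \<union> side_arcs (Z \<union> W)"
    proof
      fix e assume e: "e \<in> side_arcs (Y \<union> Z)"
      then have eA: "e \<in> A" by (simp add: side_arcs_def)
      show "e \<in> side_arcs (Y \<union> W) \<union> side_arcs (Z \<union> W)"
      proof (cases "e \<in> ?Y \<union> ?Z \<union> ?W")
        case True
        then have "path_image (\<gamma> e) \<subseteq> Y \<or> path_image (\<gamma> e) \<subseteq> Z \<or> path_image (\<gamma> e) \<subseteq> W"
          unfolding Y_def Z_def W_def drawn_def by blast
        then show ?thesis using eA unfolding side_arcs_def by blast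
      next
        case False
        have "open_edge e \<inter> drawn (?Y \<union> ?Z \<union> ?W) = {}"
          using False sub eA by (intro open_edge_avoids_drawn sym_Un sym_path_arcs) auto
        then have avoid: "open_edge e \<inter> (Y \<union> Z \<union> W) = {}"
          by (simp add: drawn_Un Y_def Z_def W_def)
        obtain p where p: "p \<in> open_edge e" using open_edge(2)[OF eA] by blast
        then have "p \<in> inside (Y \<union> Z)" using e avoid by (auto simp: side_arcs_def open_edge_def)
        then have "p \<in> inside (Y \<union> W) \<or> p \<in> inside (Z \<union> W)" using split(2) p avoid by blast
        then show ?thesis
          using edge_in_side[OF eA closed(1) _ p] edge_in_side[OF eA closed(2) _ p] avoid by blast
      qed
    qed
    then have "card (side_arcs (Y \<union> Z)) + card ?W
        \<le> card (side_arcs (Y \<union> W) \<union> side_arcs (Z \<union> W)) + card (side_arcs (Y \<union> W) \<inter> side_arcs (Z \<union> W))"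
    proof (intro add_mono card_mono)
      show "?W \<subseteq> side_arcs (Y \<union> W) \<inter> side_arcs (Z \<union> W)"
        using arcs_in_side[OF sub(3), of "Y \<union> W"] arcs_in_side[OF sub(3), of "Z \<union> W"]
        unfolding W_def by blast
    qed auto
    then have arcs: "card (side_arcs (Y \<union> Z)) + 2 * (length ws + 1)
        \<le> card (side_arcs (Y \<union> W)) + card (side_arcs (Z \<union> W))"
      using card_path_arcs[OF ear(3)]
        card_Un_Int[OF finite_side(1)[of "Y \<union> W"] finite_side(1)[of "Z \<union> W"]] by simp

    \<comment> \<open>the closed halves meet only in the ear\<close>
    have "side_verts (Y \<union> W) \<inter> side_verts (Z \<union> W) \<subseteq> set (a # ws @ [b])"
    proof
      fix v assume v: "v \<in> side_verts (Y \<union> W) \<inter> side_verts (Z \<union> W)"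
      have no: "Y \<inter> inside (Y \<union> Z) = {}" "Z \<inter> inside (Y \<union> Z) = {}"
        using inside_no_overlap[of "Y \<union> Z"] by blast+
      have "pos v \<in> W"
        using v no split(1,3) YW_sub ZW_sub YZ unfolding side_verts_def by blast
      moreover have "v \<in> V" using v by (simp add: side_verts_def)
      ultimately show "v \<in> set (a # ws @ [b])"
        using vert_in_drawnD sub(3) path_arcs_subset unfolding W_def by metis
    qed
    then have "card (side_verts (Y \<union> W) \<inter> side_verts (Z \<union> W)) \<le> length (a # ws @ [b])"
      by (meson card_length card_mono List.finite_set order_trans)
    moreover have "card (side_verts (Y \<union> W) \<union> side_verts (Z \<union> W)) \<le> card (side_verts (Y \<union> Z))"
      using side1(2) side2(2) by (intro card_mono) auto
    moreover have "card (side_verts (Y \<union> W)) + card (side_verts (Z \<union> W)) =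
        card (side_verts (Y \<union> W) \<union> side_verts (Z \<union> W)) + card (side_verts (Y \<union> W) \<inter> side_verts (Z \<union> W))"
      by (rule card_Un_Int) auto
    ultimately have verts: "card (side_verts (Y \<union> W)) + card (side_verts (Z \<union> W))
        \<le> card (side_verts (Y \<union> Z)) + (length ws + 1) + 1" by simp
    have "length xs1 + length xs2 = length xs + 2 * (length ws + 1)"
      using xs1(2) xs2(2) yz(4) by simp
    then show ?thesis unfolding S by (rule Euler_glue[OF arcs verts _ IH1 IH2])
  qed
qed

end

context plane_graph
begin

lemma interior_drawing_empty: "interior (drawn A \<union> pos ` V) = {}"
proof -
  have "drawn A = (\<Union>g\<in>\<gamma> ` A. path_image g)" by (auto simp: drawn_def)
  moreover have "Path_Connected.arc g" if "g \<in> \<gamma> ` A" for g using that arc_edge by auto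
  ultimately have "interior (drawn A) = {}"
    using interior_finite_Union_arcs_empty[of "\<gamma> ` A"] finite_arcs by simp
  moreover have "closed (drawn A)" by (rule closed_drawn) simp
  moreover have "interior (pos ` V) = {}" using finite_verts by (intro empty_interior_finite) simp
  ultimately show ?thesis by (simp add: interior_closed_Un_empty_interior)
qed

lemma inverted_drawing:
  assumes "z0 \<notin> drawn A"
  defines "f \<equiv> \<lambda>z. inverse (z - z0)"
  shows "plane_graph V A (f \<circ> pos) (\<lambda>e. f \<circ> \<gamma> e)"
proof
  have inj: "f x = f y \<Longrightarrow> x = y" for x y by (simp add: f_def)
  have contf: "continuous_on (path_image (\<gamma> e)) f" if "e \<in> A" for e
  proof -
    have "z0 \<notin> path_image (\<gamma> e)" using assms that unfolding drawn_def by blast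
    then show ?thesis unfolding f_def by (intro continuous_intros) auto
  qed
  show "inj_on (f \<circ> pos) V"
    using inj_pos inj by (auto simp: inj_on_def)
  fix u v assume uv: "(u, v) \<in> A"
  show "Path_Connected.arc (f \<circ> \<gamma> (u, v))"
  proof -
    have g: "Path_Connected.arc (\<gamma> (u, v))" by (rule arc_edge[OF uv])
    have "path (f \<circ> \<gamma> (u, v))"
      using g contf[OF uv] by (intro path_continuous_image arc_imp_path)
    moreover have "inj_on (f \<circ> \<gamma> (u, v)) {0..1}"
      using g inj unfolding arc_def by (auto simp: inj_on_def)
    ultimately show ?thesis by (simp add: arc_def)
  qed
  show "pathstart (f \<circ> \<gamma> (u, v)) = (f \<circ> pos) u" "pathfinish (f \<circ> \<gamma> (u, v)) = (f \<circ> pos) v"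
    using start_edge[OF uv] finish_edge[OF uv] by (simp_all add: pathstart_compose pathfinish_compose)
  show "f \<circ> \<gamma> (v, u) = reversepath (f \<circ> \<gamma> (u, v))"
    unfolding reverse_edge[OF uv] by (auto simp: reversepath_def)
  have "f ` (path_image (\<gamma> (u, v)) \<inter> pos ` V) = {f (pos u), f (pos v)}"
    unfolding edge_verts[OF uv] by simp
  moreover have "f ` (path_image (\<gamma> (u, v)) \<inter> pos ` V) = f ` path_image (\<gamma> (u, v)) \<inter> f ` pos ` V"
    using inj by (intro image_Int) (auto simp: inj_def)
  ultimately show "path_image (f \<circ> \<gamma> (u, v)) \<inter> (f \<circ> pos) ` V = {(f \<circ> pos) u, (f \<circ> pos) v}"
    by (simp add: path_image_compose image_comp)
next
  have inj: "inj f" by (auto simp: f_def inj_def)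
  fix e e' assume e: "e \<in> A" "e' \<in> A" "e' \<noteq> e" "e' \<noteq> prod.swap e"
  have "f ` (path_image (\<gamma> e) \<inter> path_image (\<gamma> e')) \<subseteq> f ` pos ` V"
    using edge_crossing[OF e] by (rule image_mono)
  then show "path_image (f \<circ> \<gamma> e) \<inter> path_image (f \<circ> \<gamma> e') \<subseteq> (f \<circ> pos) ` V"
    using inj by (simp add: path_image_compose image_comp image_Int)
qed

text \<open>
  The bound for the inside of one cycle is applied twice, the second time after an inversion that
  moves the outside of the cycle to the inside. Only the cycle is counted twice.
\<close>

lemma two_connected_sparse:
  assumes conn: two_connected and girth5: "\<And>xs. is_cycle A xs \<Longrightarrow> 5 \<le> length xs"
    and V: "3 \<le> card V"
  shows "3 * card A + 20 \<le> 10 * card V"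
proof -
  obtain xs where cyc: "is_cycle A xs" using two_connected_has_cycle[OF conn V] .
  then have xs: "distinct xs" "3 \<le> length xs" "cycle_arcs xs \<subseteq> A" "xs \<noteq> []"
    by (auto simp: is_cycle_def)
  define S where "S = drawn (cycle_arcs xs)"
  obtain c where c: "simple_path c" "pathfinish c = pathstart c" "path_image c = S"
    using cycle_drawing[OF cyc] unfolding S_def .
  note J = Jordan_inside_outside[OF c(1,2), unfolded c(3)]
  \<comment> \<open>the centre of inversion must be off the whole drawing, not only off the cycle\<close>
  have "\<not> inside S \<subseteq> drawn A \<union> pos ` V"
    using J interior_maximal[of "inside S" "drawn A \<union> pos ` V"] interior_drawing_empty by auto
  then obtain z0 where z0: "z0 \<in> inside S" "z0 \<notin> drawn A" "z0 \<notin> pos ` V" by blast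
  define f where "f = (\<lambda>z. inverse (z - z0))"
  have inj: "f x = f y \<Longrightarrow> x = y" for x y by (simp add: f_def)
  interpret inv: plane_graph V A "f \<circ> pos" "\<lambda>e. f \<circ> \<gamma> e"
    unfolding f_def by (rule inverted_drawing[OF z0(2)])
  have inv_drawn: "inv.drawn F = f ` drawn F" for F
    unfolding inv.drawn_def drawn_def by (simp add: path_image_compose image_UN)
  have inv_open: "inv.open_edge e = f ` open_edge e" for e
    unfolding inv.open_edge_def open_edge_def path_image_compose using inj by auto
  have swap: "p \<in> outside S \<Longrightarrow> f p \<in> inside (f ` S)"
    "p \<in> inside S \<Longrightarrow> p \<noteq> z0 \<Longrightarrow> f p \<notin> inside (f ` S)" for p
    using inversion_swaps_sides[OF c(1,2), unfolded c(3), OF z0(1), of p] by (simp_all add: f_def)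
  have closedS: "closed S" using closed_drawn[OF xs(3)] by (simp add: S_def)
  have "closed (inv.drawn (cycle_arcs xs))" using xs(3) by (rule inv.closed_drawn)
  then have closedT: "closed (f ` S)" by (simp add: inv_drawn S_def)

  have inner: "3 * card (side_arcs S) + 10 + 2 * length xs \<le> 10 * card (side_verts S)"
    using side_sparse[OF conn girth5 cyc] by (simp add: S_def)
  have outer: "3 * card (inv.side_arcs (f ` S)) + 10 + 2 * length xs \<le> 10 * card (inv.side_verts (f ` S))"
    using inv.side_sparse[OF conn girth5 cyc] by (simp add: S_def inv_drawn)

  have cycle_sides: "cycle_arcs xs \<subseteq> side_arcs S \<inter> inv.side_arcs (f ` S)"
    using arcs_in_side[OF xs(3), of S] inv.arcs_in_side[OF xs(3), of "f ` S"]
    by (simp add: inv_drawn S_def)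
  have "A \<subseteq> side_arcs S \<union> inv.side_arcs (f ` S)"
  proof
    fix e assume e: "e \<in> A"
    show "e \<in> side_arcs S \<union> inv.side_arcs (f ` S)"
    proof (cases "e \<in> cycle_arcs xs")
      case True
      then show ?thesis using cycle_sides by blast
    next
      case False
      then have avoid: "open_edge e \<inter> S = {}"
        unfolding S_def using e xs(3) by (intro open_edge_avoids_drawn) (auto simp: cycle_arcs_def)
      obtain p where p: "p \<in> open_edge e" using open_edge(2)[OF e] by blast
      then have "p \<in> inside S \<or> p \<in> outside S" using avoid J by blast
      then show ?thesis
      proof
        assume "p \<in> inside S"
        then show ?thesis using edge_in_side[OF e closedS avoid p] by blast
      next
        assume "p \<in> outside S"
        then have "f p \<in> inside (f ` S)" by (rule swap(1))
        moreover have "inv.open_edge e \<inter> f ` S = {}" using avoid inj unfolding inv_open by blast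
        moreover have "f p \<in> inv.open_edge e" using p unfolding inv_open by blast
        ultimately show ?thesis using inv.edge_in_side[OF e closedT] by blast
      qed
    qed
  qed
  then have "card A + card (cycle_arcs xs) \<le> card (side_arcs S \<union> inv.side_arcs (f ` S))
      + card (side_arcs S \<inter> inv.side_arcs (f ` S))"
    using cycle_sides by (intro add_mono card_mono) auto
  then have arcs: "card A + 2 * length xs \<le> card (side_arcs S) + card (inv.side_arcs (f ` S))"
    using card_cycle_arcs[OF xs(1,2)]
      card_Un_Int[OF finite_side(1)[of S] inv.finite_side(1)[of "f ` S"]] by simp

  have "side_verts S \<inter> inv.side_verts (f ` S) \<subseteq> set xs"
  proof
    fix v assume v: "v \<in> side_verts S \<inter> inv.side_verts (f ` S)"
    then have vV: "v \<in> V" by (simp add: side_verts_def)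
    have "pos v \<in> S"
    proof (rule ccontr)
      assume nS: "pos v \<notin> S"
      then have "pos v \<in> inside S" using v by (simp add: side_verts_def)
      moreover have "pos v \<noteq> z0" using z0(3) vV by blast
      ultimately have "f (pos v) \<notin> inside (f ` S)" by (rule swap(2))
      moreover have "f (pos v) \<notin> f ` S" using nS inj by blast
      ultimately show False using v by (simp add: inv.side_verts_def)
    qed
    then show "v \<in> set xs"
      using vert_in_drawnD[OF vV _ xs(3) cycle_arcs_subset[OF xs(4)]] by (simp add: S_def)
  qed
  then have "card (side_verts S \<inter> inv.side_verts (f ` S)) \<le> length xs"
    by (meson card_length card_mono List.finite_set order_trans)
  moreover have "card (side_verts S \<union> inv.side_verts (f ` S)) \<le> card V"
    using finite_verts by (intro card_mono) (auto simp: side_verts_def inv.side_verts_def)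
  moreover have "card (side_verts S) + card (inv.side_verts (f ` S)) =
      card (side_verts S \<union> inv.side_verts (f ` S)) + card (side_verts S \<inter> inv.side_verts (f ` S))"
    by (rule card_Un_Int) auto
  ultimately have "card (side_verts S) + card (inv.side_verts (f ` S)) \<le> card V + length xs" by simp
  then show ?thesis using arcs inner outer by linarith
qed

lemma plane_subgraph:
  assumes W: "W \<subseteq> V" "B \<subseteq> A" "B \<subseteq> W \<times> W" "sym B"
  shows "plane_graph W B pos \<gamma>"
proof -
  interpret sub: fin_sgraph W B using subgraph assms by blast
  show ?thesis
  proof
    show "inj_on pos W" using inj_pos W(1) by (rule inj_on_subset)
  next
    fix u v assume uv: "(u, v) \<in> B"
    then have A: "(u, v) \<in> A" using W(2) by blast
    show "Path_Connected.arc (\<gamma> (u, v))" "pathstart (\<gamma> (u, v)) = pos u"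
      "pathfinish (\<gamma> (u, v)) = pos v" "\<gamma> (v, u) = reversepath (\<gamma> (u, v))"
      using A arc_edge start_edge finish_edge reverse_edge by blast+
    show "path_image (\<gamma> (u, v)) \<inter> pos ` W = {pos u, pos v}"
      using edge_verts[OF A] ends_in_edge[OF A] uv W(1,3) by blast
  next
    fix e e' assume e: "e \<in> B" "e' \<in> B" "e' \<noteq> e" "e' \<noteq> prod.swap e"
    show "path_image (\<gamma> e) \<inter> path_image (\<gamma> e') \<subseteq> pos ` W"
    proof
      fix z assume z: "z \<in> path_image (\<gamma> e) \<inter> path_image (\<gamma> e')"
      obtain u v where uv: "e = (u, v)" by (cases e)
      have "z \<in> pos ` V" using edge_crossing[of e e'] e W(2) z by blast
      then have "z \<in> {pos u, pos v}" using edge_verts[of u v] e(1) W(2) z uv by blast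
      then show "z \<in> pos ` W" using e(1) uv W(3) by blast
    qed
  qed
qed

end

lemma separation_glue:
  fixes \<alpha> \<alpha>1 \<alpha>2 k m n \<nu> :: nat
  assumes "3 * \<alpha>1 + 10 \<le> 10 * (k + n)" "3 * \<alpha>2 + 10 \<le> 10 * m" "\<alpha> \<le> \<alpha>1 + \<alpha>2"
    and "\<nu> = k + m" "n \<le> 1"
  shows "3 * \<alpha> + 10 \<le> 10 * \<nu>"
  using assms by presburger

text \<open>
  A graph that is not 2-connected falls into two smaller graphs with at most one common vertex, and
  the bound is additive under gluing at a vertex.
\<close>

theorem plane_girth_5_sparse:
  assumes "plane_graph V A pos \<gamma>" "\<And>xs. is_cycle A xs \<Longrightarrow> 5 \<le> length xs" "V \<noteq> {}"
  shows "3 * card A + 10 \<le> 10 * card V"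
  using assms
proof (induction "card V" arbitrary: V A rule: less_induct)
  case less
  interpret plane_graph V A pos \<gamma> by (rule less.prems)
  note girth5 = less.prems(2)
  have sub: "3 * card (A \<inter> W \<times> W) + 10 \<le> 10 * card W" if W: "W \<subset> V" "W \<noteq> {}" for W
  proof (rule less.hyps)
    show "card W < card V" using W(1) finite_verts by (rule psubset_card_mono[rotated])
    show "plane_graph W (A \<inter> W \<times> W) pos \<gamma>"
      using W sym_arcs by (intro plane_subgraph) (auto simp: sym_def)
    show "5 \<le> length xs" if "is_cycle (A \<inter> W \<times> W) xs" for xs
      using that girth5 by (simp add: is_cycle_def)
  qed (rule W(2))
  show ?case
  proof (cases "3 \<le> card V")
    case False
    have "card V \<noteq> 0" using less.prems(3) finite_verts by simp
    then consider "card V = 1" | "card V = 2" using False by linarith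
    then show ?thesis
    proof cases
      case 1
      then obtain x where "V = {x}" by (auto simp: card_1_singleton_iff)
      then have "A = {}" using arcs_subset arcD by blast
      then show ?thesis using 1 by simp
    next
      case 2
      then obtain x y where xy: "V = {x, y}" "x \<noteq> y" by (auto simp: card_2_iff)
      then have "A \<subseteq> path_arcs [x, y]" using arcs_subset arcD by auto
      then have "card A \<le> card (path_arcs [x, y])" by (rule card_mono[OF finite_path_arcs])
      then show ?thesis using 2 card_path_arcs[of "[x, y]"] xy(2) by simp
    qed
  next
    case True
    show ?thesis
    proof (cases two_connected)
      case conn: True
      then show ?thesis using two_connected_sparse[OF conn girth5 True] by linarith
    next
      case False
      then obtain K where K: "K \<subseteq> V" "K \<noteq> {}" "2 \<le> card (V - K)" "card (A `` K - K) < 2"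
        unfolding two_connected_def by (auto simp: not_le)
      \<comment> \<open>the parts are \<open>K \<union> N\<close> and \<open>V - K\<close>, with \<open>N\<close> their at most one common vertex\<close>
      define N where "N = A `` K - K"
      have N: "N \<subseteq> V - K" "card N \<le> 1" using K(4) arcD by (auto simp: N_def)
      have finK: "finite K" "finite N" using finite_verts K(1) by (auto simp: N_def intro: finite_subset)
      have cardV: "card V = card K + card (V - K)"
        using K(1) finite_verts by (simp add: card_Diff_subset finK card_mono)
      have cKN: "card (K \<union> N) = card K + card N"
        using finK N(1) by (intro card_Un_disjoint) auto
      have "K \<union> N \<subset> V"
      proof
        show "K \<union> N \<subseteq> V" using K(1) N(1) by blast
        show "K \<union> N \<noteq> V" using cKN cardV N(2) K(3) by auto
      qed
      moreover have "V - K \<subset> V" using K(1,2) by blast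
      moreover have "K \<union> N \<noteq> {}" "V - K \<noteq> {}" using K by auto
      ultimately have "3 * card (A \<inter> (K \<union> N) \<times> (K \<union> N)) + 10 \<le> 10 * (card K + card N)"
        "3 * card (A \<inter> (V - K) \<times> (V - K)) + 10 \<le> 10 * card (V - K)"
        using sub[of "K \<union> N"] sub[of "V - K"] cKN by auto
      moreover have "card A \<le> card (A \<inter> (K \<union> N) \<times> (K \<union> N)) + card (A \<inter> (V - K) \<times> (V - K))"
      proof -
        have "A \<subseteq> (A \<inter> (K \<union> N) \<times> (K \<union> N)) \<union> (A \<inter> (V - K) \<times> (V - K))"
        proof
          fix e assume e: "e \<in> A"
          obtain s t where st: "e = (s, t)" by (cases e)
          have "s \<in> V" "t \<in> V" "(t, s) \<in> A" using e st arcD by blast+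
          then show "e \<in> (A \<inter> (K \<union> N) \<times> (K \<union> N)) \<union> (A \<inter> (V - K) \<times> (V - K))"
            using e unfolding st N_def by blast
        qed
        then have "card A \<le> card ((A \<inter> (K \<union> N) \<times> (K \<union> N)) \<union> (A \<inter> (V - K) \<times> (V - K)))"
          using finite_arcs by (intro card_mono) auto
        then show ?thesis using card_Un_le order_trans by blast
      qed
      ultimately show ?thesis using cardV N(2) by (rule separation_glue)
    qed
  qed
qed

section \<open>From inner products to inversions\<close>

lemma invert_disagreement:
  assumes D: "D \<in> orientations G" and sym: "sym (parcs G)" and uv: "(u, v) \<in> parcs G"
  shows "(u, v) \<in> invert X D \<longleftrightarrow> ((u, v) \<in> D \<longleftrightarrow> \<not> (u \<in> X \<and> v \<in> X))"
proof -
  have "(v, u) \<in> parcs G" using sym uv symD by metis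
  then show ?thesis using D uv unfolding orientations_def invert_def by blast
qed

lemma invert_orientation:
  assumes D: "D \<in> orientations G" and sym: "sym (parcs G)"
  shows "invert X D \<in> orientations G"
proof -
  have "invert X D \<subseteq> parcs G"
    using D sym unfolding orientations_def invert_def sym_def by blast
  moreover have "(u, v) \<in> invert X D \<longleftrightarrow> (v, u) \<notin> invert X D" if uv: "(u, v) \<in> parcs G" for u v
  proof -
    have vu: "(v, u) \<in> parcs G" using sym uv symD by metis
    have "(u, v) \<in> D \<longleftrightarrow> (v, u) \<notin> D" using D uv unfolding orientations_def by blast
    then show ?thesis
      using invert_disagreement[OF D sym uv] invert_disagreement[OF D sym vu] by blast
  qed
  ultimately show ?thesis unfolding orientations_def by blast
qed

lemma orientation_eqI:
  assumes "D \<in> orientations G" "D' \<in> orientations G"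
    and "\<And>u v. (u, v) \<in> parcs G \<Longrightarrow> (u, v) \<in> D \<longleftrightarrow> (u, v) \<in> D'"
  shows "D = D'"
  using assms unfolding orientations_def by auto

text \<open>
  An inversion that changes nothing is not an edge of the inversion graph and is left out of the walk,
  so the walk may be shorter than the list of sets.
\<close>

lemma inversion_walk:
  fixes G :: "'a pair_pre_digraph"
  assumes sym: "sym (parcs G)" and D: "D \<in> orientations G"
    and Xs: "\<And>X. X \<in> set Xs \<Longrightarrow> X \<subseteq> pverts G"
  shows "\<exists>p. pre_digraph.awalk (with_proj (inversion_graph G)) D p (fold invert Xs D) \<and> length p \<le> length Xs"
  using D Xs
proof (induction Xs arbitrary: D)
  case Nil
  then show ?case
    by (intro exI[of _ "[]"]) (simp add: pre_digraph.awalk_def inversion_graph_def cas_with_proj_eq)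
next
  case (Cons X Xs)
  let ?D = "invert X D"
  have D': "?D \<in> orientations G" using invert_orientation Cons.prems(1) sym by blast
  obtain p where p: "pre_digraph.awalk (with_proj (inversion_graph G)) ?D p (fold invert Xs ?D)"
      "length p \<le> length Xs"
    using Cons.IH[OF D'] Cons.prems(2) by auto
  show ?case
  proof (cases "?D = D")
    case True
    then show ?thesis using p by (intro exI[of _ p]) auto
  next
    case False
    then have "(D, ?D) \<in> parcs (inversion_graph G)"
      using D' Cons.prems(1) Cons.prems(2)[of X] unfolding inversion_graph_def by auto
    then have "pre_digraph.awalk (with_proj (inversion_graph G)) D ((D, ?D) # p) (fold invert Xs ?D)"
      using p(1) Cons.prems(1)
      by (simp add: pre_digraph.awalk_def cas_with_proj_eq) (simp add: inversion_graph_def)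
    then show ?thesis using p(2) by (intro exI[of _ "(D, ?D) # p"]) auto
  qed
qed

lemma fold_invert:
  assumes "D \<in> orientations G" "sym (parcs G)" "(u, v) \<in> parcs G"
  shows "(u, v) \<in> fold invert Xs D \<longleftrightarrow>
    ((u, v) \<in> D \<longleftrightarrow> even (length (filter (\<lambda>X. u \<in> X \<and> v \<in> X) Xs)))"
  using assms(1)
proof (induction Xs arbitrary: D)
  case (Cons X Xs)
  then show ?case
    using Cons.IH[OF invert_orientation[OF Cons.prems assms(2)]]
      invert_disagreement[OF Cons.prems assms(2,3)] by auto
qed simp

lemma fold_invert_orientation:
  assumes "sym (parcs G)"
  shows "D \<in> orientations G \<Longrightarrow> fold invert Xs D \<in> orientations G"
  by (induction Xs arbitrary: D) (use assms invert_orientation in auto)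

lemma dot_bit_parity:
  "dot x y = of_bool (odd (card {i. x $ i = 1 \<and> y $ i = (1 :: bit)}))"
proof -
  have "dot x y = (\<Sum>i\<in>UNIV. if x $ i = 1 \<and> y $ i = 1 then 1 else 0)"
    unfolding dot_def by (intro sum.cong) auto
  also have "\<dots> = of_nat (card {i. x $ i = 1 \<and> y $ i = 1})"
    by (simp add: sum.If_cases)
  also have "\<dots> = of_bool (odd (card {i. x $ i = 1 \<and> y $ i = 1}))"
  proof (cases "even (card {i. x $ i = 1 \<and> y $ i = 1})")
    case True
    then show ?thesis by (auto elim!: evenE)
  next
    case False
    then show ?thesis by (auto elim!: oddE)
  qed
  finally show ?thesis .
qed

text \<open>
  The label of an edge records whether the two orientations disagree on it, and the inversion with
  index \<open>i\<close> is performed at the vertices whose vector has \<open>i\<close>-th coordinate 1.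
\<close>

lemma inversion_diameter_le:
  fixes G :: "'a pair_pre_digraph"
  assumes sym: "sym (parcs G)" and sub: "parcs G \<subseteq> pverts G \<times> pverts G"
    and assignment: "\<And>p. (\<And>u v. p u v = p v u) \<Longrightarrow>
      \<exists>X :: 'a \<Rightarrow> bit ^ 'n. dot_assignment (parcs G) (pverts G) p X"
  shows "graph_diameter (inversion_graph G) \<le> enat CARD('n)"
  unfolding graph_diameter_def
proof (intro SUP_least)
  fix D D' assume "D \<in> pverts (inversion_graph G)" "D' \<in> pverts (inversion_graph G)"
  then have D: "D \<in> orientations G" and D': "D' \<in> orientations G"
    by (simp_all add: inversion_graph_def)
  have swap: "(u, v) \<in> E \<longleftrightarrow> (v, u) \<notin> E" if "E \<in> orientations G" "(u, v) \<in> parcs G" for E u v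
    using that unfolding orientations_def by blast
  define p :: "'a \<Rightarrow> 'a \<Rightarrow> bit" where
    "p u v = of_bool ({(u, v), (v, u)} \<inter> D \<noteq> {(u, v), (v, u)} \<inter> D')" for u v
  have "p u v = p v u" for u v by (simp add: p_def insert_commute)
  from assignment[of p, OF this] obtain X :: "'a \<Rightarrow> bit ^ 'n"
    where X: "dot_assignment (parcs G) (pverts G) p X" by blast
  obtain idx :: "'n list" where idx: "set idx = UNIV" "distinct idx"
    using finite_distinct_list[of "UNIV :: 'n set"] by auto
  define Xs where "Xs = map (\<lambda>i. {v \<in> pverts G. X v $ i = 1}) idx"
  have "length idx = CARD('n)" using idx distinct_card by fastforce
  then have len: "length Xs = CARD('n)" by (simp add: Xs_def)
  have "fold invert Xs D = D'"
  proof (rule orientation_eqI[OF fold_invert_orientation[OF sym D] D'])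
    fix u v assume uv: "(u, v) \<in> parcs G"
    have V: "u \<in> pverts G" "v \<in> pverts G" using uv sub by auto
    have "length (filter (\<lambda>X. u \<in> X \<and> v \<in> X) Xs) = length (filter (\<lambda>i. X u $ i = 1 \<and> X v $ i = 1) idx)"
      using V by (simp add: Xs_def filter_map comp_def)
    also have "\<dots> = card (set (filter (\<lambda>i. X u $ i = 1 \<and> X v $ i = 1) idx))"
      using idx(2) by (simp add: distinct_card del: set_filter)
    also have "set (filter (\<lambda>i. X u $ i = 1 \<and> X v $ i = 1) idx) = {i. X u $ i = 1 \<and> X v $ i = 1}"
      using idx(1) by auto
    finally have "odd (length (filter (\<lambda>X. u \<in> X \<and> v \<in> X) Xs)) \<longleftrightarrow> dot (X u) (X v) = 1"
      by (simp only: dot_bit_parity) auto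
    also have "\<dots> \<longleftrightarrow> p u v = 1" using dot_assignmentD(2)[OF X V uv] by simp
    also have "\<dots> \<longleftrightarrow> {(u, v), (v, u)} \<inter> D \<noteq> {(u, v), (v, u)} \<inter> D'" by (simp add: p_def)
    also have "\<dots> \<longleftrightarrow> ((u, v) \<in> D \<longleftrightarrow> (u, v) \<notin> D')"
      using swap[OF D uv] swap[OF D' uv] by blast
    finally show "(u, v) \<in> fold invert Xs D \<longleftrightarrow> (u, v) \<in> D'"
      using fold_invert[OF D sym uv, of Xs] by blast
  qed
  moreover have "X \<subseteq> pverts G" if "X \<in> set Xs" for X using that by (auto simp: Xs_def)
  ultimately obtain w where "pre_digraph.awalk (with_proj (inversion_graph G)) D w D'" "length w \<le> CARD('n)"
    using inversion_walk[OF sym D, of Xs] len by auto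
  then show "graph_dist (inversion_graph G) D D' \<le> enat CARD('n)"
    unfolding graph_dist_def by (intro INF_lower2[of w]) auto
qed

text \<open>
  A cyclic list of vertices is read as the closed walk of its arcs, starting from the first vertex.
\<close>

lemma girth_le_cycle_length:
  fixes G :: "'a pair_pre_digraph"
  assumes "parcs G \<subseteq> pverts G \<times> pverts G" "is_cycle (parcs G) xs"
  shows "girth G \<le> enat (length xs)"
proof -
  have walk: "pcas x (zip (x # ys) (ys @ [z])) z \<and> pawalk_verts x (zip (x # ys) (ys @ [z])) = x # ys @ [z]"
    for x z :: 'a and ys
    by (induction ys arbitrary: x) auto
  have arcs: "set (zip (x # ys) (ys @ [z])) \<subseteq> path_arcs (x # ys @ [z])" for x z :: 'a and ys
    by (induction ys arbitrary: x) auto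
  obtain x ys where xs: "xs = x # ys" using assms(2) by (cases xs) (auto simp: is_cycle_def)
  let ?p = "zip (x # ys) (ys @ [x])"
  have "set ?p \<subseteq> parcs G" using arcs[of x ys x] assms(2) by (auto simp: xs is_cycle_def cycle_arcs_def)
  moreover have "x \<in> pverts G" using assms by (cases ys) (auto simp: xs is_cycle_def cycle_arcs_def)
  moreover have "distinct (tl (pawalk_verts x ?p))" using walk[of x ys x] assms(2) by (auto simp: xs is_cycle_def)
  moreover have "?p \<noteq> []" by (cases ys) auto
  ultimately have "pre_digraph.cycle (with_proj G) ?p"
    unfolding pre_digraph.cycle_def pre_digraph.awalk_def cas_with_proj_eq awalk_verts_with_proj_eq
    using walk[of x ys x] by auto
  moreover have "length ?p = length xs" by (simp add: xs)
  ultimately show ?thesis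
    unfolding girth_def using assms(2) by (intro INF_lower2[of ?p]) (auto simp: is_cycle_def)
qed


theorem theorem1p4:
  fixes G :: "'a pair_pre_digraph"
  assumes "pair_graph G"
    and "planar G"
    and "girth G \<ge> 5"
  shows "graph_diameter (inversion_graph G) \<le> 5"
proof -
  interpret G: pair_graph G by (rule assms(1))
  let ?V = "pverts G" and ?A = "parcs G"
  have sub: "?A \<subseteq> ?V \<times> ?V" using G.in_arcsD1 G.in_arcsD2 by auto
  have sym: "sym ?A" using G.arcs_symmetric by (auto intro: symI)
  have sgraph: "fin_sgraph ?V ?A"
    using sub sym G.no_loops' by unfold_locales (auto simp: irrefl_def)
  obtain pos \<gamma> where draw: "plane_drawing G pos \<gamma>" using assms(2) unfolding planar_def by blast
  interpret plane: plane_graph ?V ?A pos \<gamma>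
  proof (intro plane_graph.intro plane_graph_axioms.intro sgraph)
    show "inj_on pos ?V" using draw by (simp add: plane_drawing_def)
  qed (use draw[unfolded plane_drawing_def] in blast)+
  have girth5: "5 \<le> length xs" if "is_cycle ?A xs" for xs
  proof -
    have "5 \<le> enat (length xs)"
      using girth_le_cycle_length[OF sub that] assms(3) by (rule order_trans[rotated])
    then show ?thesis by (simp add: numeral_eq_enat)
  qed
  have assignment: "\<exists>X :: 'a \<Rightarrow> bit ^ 5. dot_assignment ?A ?V p X" if "\<And>u v. p u v = p v u" for p
  proof (rule sparse_dot_assignment[OF sgraph _ _ that])
    fix a b c assume abc: "(a, b) \<in> ?A" "(b, c) \<in> ?A"
    show "(c, a) \<notin> ?A"
    proof
      assume "(c, a) \<in> ?A"
      then have "is_cycle ?A [a, b, c]"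
        using abc plane.arcD by (auto simp: is_cycle_def cycle_arcs_def)
      then show False using girth5 by force
    qed
  next
    fix W B assume W: "W \<subseteq> ?V" "W \<noteq> {}" "B \<subseteq> ?A" "B \<subseteq> W \<times> W" "sym B"
    have "plane_graph W B pos \<gamma>" using W by (intro plane.plane_subgraph)
    moreover have "5 \<le> length xs" if "is_cycle B xs" for xs
      using that W(3) girth5 by (auto simp: is_cycle_def)
    ultimately have "3 * card B + 10 \<le> 10 * card W" using W(2) by (rule plane_girth_5_sparse)
    then show "3 * card B < 10 * card W" by simp
  qed
  have "graph_diameter (inversion_graph G) \<le> enat CARD(5)"
    by (rule inversion_diameter_le[where 'n = 5, OF sym sub]) (rule assignment)
  then show ?thesis by (simp add: numeral_eq_enat)
qed

end
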